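(* Let $E$ be a nonzero real Banach space and $S\colon E\rightrightarrows E^*$ be closed, monotone and quasidense. Then: (i) whenever $w\in E$ and $\widetilde W$ is a nonempty $w(E^*,E)$-compact convex subset of $E^*$ such that $\max_{x^*\in\widetilde W}\langle s-w,s^*-x^*\rangle\ge0$ for all $(s,s^* )\in G(S)$, we have $S(w)\cap\widetilde W\ne\emptyset$; (ii) whenever $W$ is a nonempty $w(E,E^* )$-compact convex subset of $E$ and $w^*\in E^*$ are such that $\max_{x\in W}\langle s-x,s^*-w^*\rangle\ge0$ for all $(s,s^* )\in G(S)$, we have $w^*\in S(W)=\bigcup_{x\in W}S(x)$.
   Context: For a multifunction $S\colon E\rightrightarrows E^*$ with nonempty graph $G(S)$: closed means $G(S)$ norm-closed; monotone means $\langle s-t,s^*-t^*\rangle\ge0$ on $G(S)$; quasidense means for every $(x,x^* )\in E\times E^*$, $\inf_{(s,s^* )\in G(S)}[\tfrac12\|s-x\|^2+\tfrac12\|s^*-x^*\|^2+\langle s-x,s^*-x^*\rangle]\le0$. *)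

theory Defs
  imports "HOL-Analysis.Analysis"
begin

(* The dual space E* is the type ('a =>L real) of bounded linear functionals;
   the pairing is blinfun_apply. A multifunction S is identified with its graph G(S). *)

definition weak_topology :: "('a::real_normed_vector) topology" where
  "weak_topology = topology_generated_by
     {{x. blinfun_apply f x \<in> U} | (f :: 'a \<Rightarrow>\<^sub>L real) U. open U}"

definition weak_star_topology :: "('a::real_normed_vector \<Rightarrow>\<^sub>L real) topology" where
  "weak_star_topology = topology_generated_by
     {{f. blinfun_apply f x \<in> U} | x U. open U}"

definition monotone_graph :: "('a::real_normed_vector \<times> ('a \<Rightarrow>\<^sub>L real)) set \<Rightarrow> bool" where
  "monotone_graph G \<longleftrightarrow>
     (\<forall>(s, s') \<in> G. \<forall>(t, t') \<in> G. blinfun_apply (s' - t') (s - t) \<ge> 0)"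

definition quasidense :: "('a::real_normed_vector \<times> ('a \<Rightarrow>\<^sub>L real)) set \<Rightarrow> bool" where
  "quasidense G \<longleftrightarrow>
     (\<forall>x x'. (INF p\<in>G. norm (fst p - x)^2 / 2 + norm (snd p - x')^2 / 2
                         + blinfun_apply (snd p - x') (fst p - x)) \<le> 0)"

end

theory Submission
  imports Defs
begin

text \<open>After a translation take \<open>w = 0\<close> in (i), and let \<open>p y\<close> be the maximum of \<open>- x' y\<close> over \<open>x' \<in> Wt\<close>. The
  hypothesis says \<open>s' s + p s \<ge> 0\<close> on \<open>G\<close>. With \<open>g y = p y + (norm y)\<^sup>2 / 2\<close>, Fenchel duality on
  \<open>E \<times> E*\<close> together with quasidensity produces points of \<open>G\<close> at which \<open>g s + g* (- s') + s' s\<close> is almost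
  zero: duality first gives a convex combination of points of \<open>G\<close>, and quasidensity at that
  combination gives a point of \<open>G\<close> close to it. By the hypothesis such points satisfy \<open>s \<rightarrow> 0\<close> and
  \<open>g* (- s') \<rightarrow> 0\<close>. Monotonicity against them shows that every convex combination of the
  functions \<open>x' \<mapsto> (t' - x') t\<close>, \<open>(t, t') \<in> G\<close>, is nonnegative somewhere on \<open>Wt\<close>; the minimax theorem yields one
  \<open>x' \<in> Wt\<close> at which all of them are nonnegative, and then \<open>(0, x') \<in> G\<close> because closed
  quasidense graphs are maximal. Part (ii) is the same argument with the roles of \<open>E\<close> and \<open>E*\<close>
  exchanged, so both are derived for an abstract normed pairing.\<close>

subsection \<open>Linear functionals below convex functions\<close>

text \<open>Homogeneity is asked only as an inequality for positive \<open>t\<close>, which is what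
  passes directly to infima; applying it to \<open>1/t\<close> as well gives equality in
  \<open>sublinear_scale\<close>.\<close>

definition sublinear :: "('a::real_vector \<Rightarrow> real) \<Rightarrow> bool" where
  "sublinear p \<longleftrightarrow> (\<forall>x y. p (x + y) \<le> p x + p y) \<and> (\<forall>t>0. \<forall>x. p (t *\<^sub>R x) \<le> t * p x)"

lemma sublinear_add: "sublinear p \<Longrightarrow> p (x + y) \<le> p x + p y"
  by (simp add: sublinear_def)

lemma sublinear_scale:
  assumes "sublinear p" "t > 0"
  shows "p (t *\<^sub>R x) = t * p x"
proof (rule antisym)
  show "p (t *\<^sub>R x) \<le> t * p x"
    using assms by (simp add: sublinear_def)
  have "p ((1/t) *\<^sub>R (t *\<^sub>R x)) \<le> (1/t) * p (t *\<^sub>R x)"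
    using assms unfolding sublinear_def by (meson divide_pos_pos zero_less_one)
  then show "t * p x \<le> p (t *\<^sub>R x)"
    using assms by (simp add: field_simps)
qed

lemma sublinear_zero: "sublinear p \<Longrightarrow> p 0 = 0"
  using sublinear_scale[of p 2 0] by simp

lemma sublinear_scale_nonneg: "sublinear p \<Longrightarrow> t \<ge> 0 \<Longrightarrow> p (t *\<^sub>R x) = t * p x"
  using sublinear_scale[of p t x] sublinear_zero[of p] by (cases "t = 0") auto

lemma sublinear_ge_minus: "sublinear p \<Longrightarrow> - p (- x) \<le> p x"
  using sublinear_add[of p x "- x"] sublinear_zero[of p] by simp

text \<open>Zorn's lemma for the reversed pointwise order. A chain has its pointwise infimum as a
  lower bound, which is finite because every sublinear \<open>f\<close> below \<open>p\<close>
  satisfies \<open>- p (- x) \<le> f x\<close>.\<close>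

lemma ex_minimal_sublinear:
  fixes p :: "'a::real_vector \<Rightarrow> real"
  assumes p: "sublinear p"
  obtains f where "sublinear f" "f \<le> p" "\<And>g. sublinear g \<Longrightarrow> g \<le> f \<Longrightarrow> g = f"
proof -
  define A where "A = {f. sublinear f \<and> f \<le> p}"
  have "\<exists>m\<in>A. \<forall>a\<in>A. a \<le> m \<longrightarrow> a = m"
  proof (rule predicate_Zorn)
    show "partial_order_on A (relation_of (\<lambda>a b. b \<le> a) A)"
      by (rule partial_order_on_relation_ofI) auto
    fix C assume C: "C \<in> Chains (relation_of (\<lambda>a b. b \<le> a) A)"
    then have CA: "C \<subseteq> A" and tot: "\<And>f g. f \<in> C \<Longrightarrow> g \<in> C \<Longrightarrow> f \<le> g \<or> g \<le> f"
      by (auto simp: Chains_def relation_of_def)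
    show "\<exists>u\<in>A. \<forall>a\<in>C. u \<le> a"
    proof (cases "C = {}")
      case True
      then show ?thesis using p by (auto simp: A_def)
    next
      case False
      define u where "u x = (INF f\<in>C. f x)" for x
      have lb: "- p (- x) \<le> f x" if "f \<in> C" for f x
      proof -
        have "sublinear f" "f (- x) \<le> p (- x)" using that CA by (auto simp: A_def le_fun_def)
        then show ?thesis using sublinear_ge_minus[of f x] by linarith
      qed
      have u_le: "u x \<le> f x" if "f \<in> C" for f x
        unfolding u_def by (rule cINF_lower[OF bdd_belowI2 that]) (rule lb)
      have u_ge: "b \<le> u x" if "\<And>f. f \<in> C \<Longrightarrow> b \<le> f x" for b x
        unfolding u_def by (rule cINF_greatest[OF False that])
      \<comment> \<open>The infima at \<open>x\<close> and at \<open>y\<close> may be approached by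
        different members of the chain; the smaller of the two serves for both.\<close>
      have add2: "u (x + y) \<le> f x + g y" if fg: "f \<in> C" "g \<in> C" for f g x y
      proof -
        obtain k where k: "k \<in> C" "k \<le> f" "k \<le> g" using tot[OF fg] fg by blast
        have "u (x + y) \<le> k (x + y)" by (rule u_le[OF k(1)])
        also have "\<dots> \<le> k x + k y" using k CA by (intro sublinear_add) (auto simp: A_def)
        also have "\<dots> \<le> f x + g y" using k by (intro add_mono) (auto simp: le_fun_def)
        finally show ?thesis .
      qed
      have "u (x + y) \<le> u x + u y" for x y
      proof -
        have "u (x + y) - g y \<le> u x" if "g \<in> C" for g
          using add2[OF _ that, of _ x y] by (intro u_ge) (simp add: algebra_simps)
        then have "u (x + y) - u x \<le> u y"
          by (intro u_ge) (simp add: algebra_simps)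
        then show ?thesis by linarith
      qed
      moreover have "u (t *\<^sub>R x) \<le> t * u x" if "t > 0" for t x
      proof -
        have "u (t *\<^sub>R x) / t \<le> u x"
        proof (rule u_ge)
          fix f assume f: "f \<in> C"
          then have "f (t *\<^sub>R x) = t * f x"
            using CA that by (intro sublinear_scale) (auto simp: A_def)
          then show "u (t *\<^sub>R x) / t \<le> f x"
            using u_le[OF f, of "t *\<^sub>R x"] that by (simp add: field_simps)
        qed
        then show ?thesis using that by (simp add: field_simps)
      qed
      ultimately have "sublinear u" by (simp add: sublinear_def)
      moreover have "u \<le> p"
      proof -
        obtain f where "f \<in> C" using False by blast
        then show ?thesis using u_le[of f] CA by (force simp: A_def le_fun_def intro: order_trans)
      qed
      ultimately show ?thesis
        using u_le by (auto simp: A_def le_fun_def)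
    qed
  qed
  then obtain f where f: "f \<in> A" "\<And>a. a \<in> A \<Longrightarrow> a \<le> f \<Longrightarrow> a = f" by blast
  show ?thesis
  proof (rule that[of f])
    show "sublinear f" "f \<le> p" using f(1) by (auto simp: A_def)
    show "g = f" if "sublinear g" "g \<le> f" for g
      using f that by (auto simp: A_def intro: order_trans)
  qed
qed

text \<open>The function \<open>g\<close> of the proof is sublinear with \<open>g \<le> f\<close> and \<open>g x \<le> f (x + y) - f y\<close>,
  so minimality makes \<open>f\<close> superadditive.\<close>

lemma minimal_sublinear_linear:
  fixes f :: "'a::real_vector \<Rightarrow> real"
  assumes f: "sublinear f" and min: "\<And>g. sublinear g \<Longrightarrow> g \<le> f \<Longrightarrow> g = f"
  shows "linear f"
proof -
  have super: "f x + f y \<le> f (x + y)" for x y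
  proof -
    define g where "g x = (INF t\<in>{0..}. f (x + t *\<^sub>R y) - t * f y)" for x
    have lb: "- f (- x) \<le> f (x + t *\<^sub>R y) - t * f y" if "t \<in> {0..}" for t x
      using sublinear_add[OF f, of "x + t *\<^sub>R y" "- x"] sublinear_scale_nonneg[OF f, of t y] that
      by simp
    have g_le: "g x \<le> f (x + t *\<^sub>R y) - t * f y" if "t \<ge> 0" for t x
      unfolding g_def by (rule cINF_lower[OF bdd_belowI2]) (rule lb, use that in auto)
    have g_ge: "b \<le> g x" if "\<And>t. t \<ge> 0 \<Longrightarrow> b \<le> f (x + t *\<^sub>R y) - t * f y" for b x
      unfolding g_def using that by (intro cINF_greatest) auto
    have "g (a + b) \<le> g a + g b" for a b
    proof -
      have 1: "g (a + b) \<le> f (a + s *\<^sub>R y) - s * f y + (f (b + t *\<^sub>R y) - t * f y)"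
        if "s \<ge> 0" "t \<ge> 0" for s t
      proof -
        have "g (a + b) \<le> f ((a + b) + (s + t) *\<^sub>R y) - (s + t) * f y"
          using that by (intro g_le) simp
        also have "(a + b) + (s + t) *\<^sub>R y = (a + s *\<^sub>R y) + (b + t *\<^sub>R y)"
          by (simp add: algebra_simps)
        finally show ?thesis
          using sublinear_add[OF f, of "a + s *\<^sub>R y" "b + t *\<^sub>R y"] by (simp add: algebra_simps)
      qed
      have "g (a + b) - (f (b + t *\<^sub>R y) - t * f y) \<le> g a" if "t \<ge> 0" for t
        using 1[OF _ that] by (intro g_ge) (simp add: algebra_simps)
      then have "g (a + b) - g a \<le> g b"
        by (intro g_ge) (simp add: algebra_simps)
      then show ?thesis by linarith
    qed
    moreover have "g (s *\<^sub>R a) \<le> s * g a" if s: "s > 0" for s a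
    proof -
      have "g (s *\<^sub>R a) / s \<le> g a"
      proof (rule g_ge)
        fix t :: real assume t: "t \<ge> 0"
        have "g (s *\<^sub>R a) \<le> f (s *\<^sub>R a + (s * t) *\<^sub>R y) - s * t * f y"
          using s t by (intro g_le) simp
        also have "s *\<^sub>R a + (s * t) *\<^sub>R y = s *\<^sub>R (a + t *\<^sub>R y)"
          by (simp add: algebra_simps)
        also have "f (s *\<^sub>R (a + t *\<^sub>R y)) = s * f (a + t *\<^sub>R y)"
          by (rule sublinear_scale[OF f s])
        finally have "g (s *\<^sub>R a) \<le> (f (a + t *\<^sub>R y) - t * f y) * s"
          by (simp add: algebra_simps)
        then show "g (s *\<^sub>R a) / s \<le> f (a + t *\<^sub>R y) - t * f y"
          using s by (simp only: pos_divide_le_eq)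
      qed
      then show ?thesis using s by (simp add: field_simps)
    qed
    ultimately have "sublinear g" by (simp add: sublinear_def)
    moreover have "g \<le> f" using g_le[of 0] by (simp add: le_fun_def)
    ultimately have "g = f" by (rule min)
    then show ?thesis using g_le[of 1 x] by simp
  qed
  have add: "f (x + y) = f x + f y" for x y
    using super sublinear_add[OF f] by (intro antisym) auto
  have neg: "f (- x) = - f x" for x
    using add[of x "- x"] sublinear_zero[OF f] by simp
  show ?thesis
  proof (rule linearI)
    show "f (c *\<^sub>R x) = c *\<^sub>R f x" for c x
      using sublinear_scale_nonneg[OF f, of c x] sublinear_scale_nonneg[OF f, of "- c" x] neg[of "c *\<^sub>R x"]
      by (cases "c \<ge> 0") auto
  qed (rule add)
qed

text \<open>This is the Hahn-Banach theorem in the form used below.\<close>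

lemma ex_linear_below_sublinear:
  assumes "sublinear p"
  obtains f where "linear f" "\<And>x. f x \<le> p x"
proof -
  obtain f where f: "sublinear f" "f \<le> p" "\<And>g. sublinear g \<Longrightarrow> g \<le> f \<Longrightarrow> g = f"
    using ex_minimal_sublinear[OF assms] by blast
  show ?thesis
    using that[of f] minimal_sublinear_linear[OF f(1,3)] f(2) by (auto simp: le_fun_def)
qed

text \<open>The one-sided directional derivative \<open>p\<close> of \<open>m\<close> at 0 is
  sublinear, and a linear functional below it is a subgradient, as the quotient at
  \<open>t = 1\<close> shows. Boundedness of the functional is established at each use.\<close>

lemma ex_subgradient_at_zero:
  fixes m :: "'a::real_vector \<Rightarrow> real"
  assumes m: "convex_on UNIV m"
  obtains f where "linear f" "\<And>x. m 0 + f x \<le> m x"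
proof -
  define p where "p x = (INF t\<in>{0<..}. (m (t *\<^sub>R x) - m 0) / t)" for x
  have cv: "m ((1 - t) *\<^sub>R x + t *\<^sub>R y) \<le> (1 - t) * m x + t * m y" if "0 \<le> t" "t \<le> 1" for t x y
    using convex_onD[OF m that] by simp
  have lb: "m 0 - m (- x) \<le> (m (t *\<^sub>R x) - m 0) / t" if "t \<in> {0<..}" for t x
  proof -
    \<comment> \<open>With this weight 0 is a convex combination of \<open>t *\<^sub>R x\<close> and
      \<open>- x\<close>, which bounds the difference quotients from below uniformly in
      \<open>t\<close>.\<close>
    define l where "l = t / (1 + t)"
    have t: "t > 0" using that by simp
    have l: "0 \<le> l" "l \<le> 1" "(1 - l) * t = l" "(1 + t) * (1 - l) = 1" "(1 + t) * l = t"
      using t by (auto simp: l_def field_simps)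
    have "(1 - l) *\<^sub>R (t *\<^sub>R x) + l *\<^sub>R (- x) = 0" by (simp add: l)
    then have "m 0 \<le> (1 - l) * m (t *\<^sub>R x) + l * m (- x)"
      using cv[OF l(1,2), of "t *\<^sub>R x" "- x"] by (simp only:)
    then have "(1 + t) * m 0 \<le> (1 + t) * ((1 - l) * m (t *\<^sub>R x) + l * m (- x))"
      using t by (intro mult_left_mono) auto
    also have "\<dots> = ((1 + t) * (1 - l)) * m (t *\<^sub>R x) + ((1 + t) * l) * m (- x)"
      by (simp only: distrib_left mult.assoc)
    finally have "(m 0 - m (- x)) * t \<le> m (t *\<^sub>R x) - m 0"
      unfolding l by (simp add: algebra_simps)
    then show ?thesis using t by (simp only: pos_le_divide_eq)
  qed
  have p_le: "p x \<le> (m (t *\<^sub>R x) - m 0) / t" if "t > 0" for t x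
    unfolding p_def by (rule cINF_lower[OF bdd_belowI2]) (rule lb, use that in auto)
  have p_ge: "b \<le> p x" if "\<And>t. t > 0 \<Longrightarrow> b \<le> (m (t *\<^sub>R x) - m 0) / t" for b x
    unfolding p_def using that by (intro cINF_greatest) auto
  have "p (a + b) \<le> p a + p b" for a b
  proof -
    have 1: "p (a + b) \<le> (m (s *\<^sub>R a) - m 0) / s + (m (t *\<^sub>R b) - m 0) / t" if st: "s > 0" "t > 0" for s t
    proof -
      \<comment> \<open>This step size makes \<open>r *\<^sub>R (a + b)\<close> a convex combination
        of \<open>s *\<^sub>R a\<close> and \<open>t *\<^sub>R b\<close>, and dividing the weights
        by \<open>r\<close> leaves exactly \<open>1 / s\<close> and \<open>1 / t\<close>.\<close>
      define r where "r = s * t / (s + t)"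
      have r: "r > 0" using st by (simp add: r_def)
      define l where "l = s / (s + t)"
      have l: "0 \<le> l" "l \<le> 1" "(1 - l) * s = r" "l * t = r"
        using st by (auto simp: l_def r_def field_simps)
      have lr: "(1 - l) / r = 1 / s" "l / r = 1 / t"
        using st r l(3,4) by (auto simp: frac_eq_eq)
      have eq: "r *\<^sub>R (a + b) = (1 - l) *\<^sub>R (s *\<^sub>R a) + l *\<^sub>R (t *\<^sub>R b)"
        by (simp add: l scaleR_add_right)
      have "m (r *\<^sub>R (a + b)) \<le> (1 - l) * m (s *\<^sub>R a) + l * m (t *\<^sub>R b)"
        unfolding eq by (intro cv l)
      then have "m (r *\<^sub>R (a + b)) - m 0 \<le> (1 - l) * (m (s *\<^sub>R a) - m 0) + l * (m (t *\<^sub>R b) - m 0)"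
        by (simp add: algebra_simps)
      then have "(m (r *\<^sub>R (a + b)) - m 0) / r \<le>
          ((1 - l) * (m (s *\<^sub>R a) - m 0) + l * (m (t *\<^sub>R b) - m 0)) / r"
        using r by (intro divide_right_mono) auto
      also have "\<dots> = ((1 - l) / r) * (m (s *\<^sub>R a) - m 0) + (l / r) * (m (t *\<^sub>R b) - m 0)"
        by (simp add: add_divide_distrib)
      also have "\<dots> = (m (s *\<^sub>R a) - m 0) / s + (m (t *\<^sub>R b) - m 0) / t"
        by (simp add: lr)
      finally show ?thesis using p_le[OF r, of "a + b"] by linarith
    qed
    have "p (a + b) - (m (t *\<^sub>R b) - m 0) / t \<le> p a" if "t > 0" for t
      using 1[OF _ that] by (intro p_ge) (simp add: algebra_simps)
    then have "p (a + b) - p a \<le> p b"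
      by (intro p_ge) (simp add: algebra_simps)
    then show ?thesis by linarith
  qed
  moreover have "p (s *\<^sub>R a) \<le> s * p a" if s: "s > 0" for s a
  proof -
    have "p (s *\<^sub>R a) / s \<le> p a"
    proof (rule p_ge)
      fix t :: real assume "t > 0"
      then show "p (s *\<^sub>R a) / s \<le> (m (t *\<^sub>R a) - m 0) / t"
        using p_le[of "t / s" "s *\<^sub>R a"] s by (simp add: field_simps)
    qed
    then show ?thesis using s by (simp add: field_simps)
  qed
  ultimately have "sublinear p" by (simp add: sublinear_def)
  then obtain f where f: "linear f" "\<And>x. f x \<le> p x" by (rule ex_linear_below_sublinear) blast
  show ?thesis
  proof (rule that[OF f(1)])
    show "m 0 + f x \<le> m x" for x
      using f(2)[of x] p_le[of 1 x] by simp
  qed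
qed

section \<open>Bounded functionals: norming functionals and uniform boundedness\<close>

lemma bounded_linear_if_bounded_above:
  fixes f :: "'a::real_normed_vector \<Rightarrow> real"
  assumes f: "linear f" and B: "\<And>x. norm x \<le> 1 \<Longrightarrow> f x \<le> B"
  shows "bounded_linear f"
proof (rule bounded_linear_intro)
  show "f (x + y) = f x + f y" "f (r *\<^sub>R x) = r *\<^sub>R f x" for x y r
    using f by (auto simp: linear_iff)
  have le: "f x \<le> norm x * B" for x
  proof (cases "x = 0")
    case False
    have "f (x /\<^sub>R norm x) \<le> B" using False by (intro B) simp
    then show ?thesis using False linear_scale[OF f] by (simp add: field_simps)
  qed (simp add: linear_0[OF f])
  show "norm (f x) \<le> norm x * B" for x
    using le[of x] le[of "- x"] linear_neg[OF f] by simp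
qed

text \<open>Take a subgradient at 0 of \<open>\<lambda>v. norm (x + v)\<close>: the triangle
  inequality bounds it by the norm, and testing \<open>v = - x\<close> gives
  \<open>f x \<ge> norm x\<close>.\<close>

lemma ex_norming_functional:
  fixes x :: "'a::real_normed_vector"
  obtains f :: "'a \<Rightarrow>\<^sub>L real" where "norm f \<le> 1" "blinfun_apply f x = norm x"
proof -
  have "convex_on UNIV (\<lambda>v. norm (x + v))"
  proof (rule convex_onI)
    fix t :: real and a b :: 'a assume t: "0 < t" "t < 1"
    have "x + ((1 - t) *\<^sub>R a + t *\<^sub>R b) = (1 - t) *\<^sub>R (x + a) + t *\<^sub>R (x + b)"
      by (simp add: algebra_simps)
    also have "norm \<dots> \<le> (1 - t) * norm (x + a) + t * norm (x + b)"
      using t by (intro norm_triangle_le) simp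
    finally show "norm (x + ((1 - t) *\<^sub>R a + t *\<^sub>R b)) \<le> (1 - t) * norm (x + a) + t * norm (x + b)" .
  qed simp
  from ex_subgradient_at_zero[OF this]
  obtain f where f: "linear f" "\<And>v. norm (x + 0) + f v \<le> norm (x + v)"
    by blast
  have le: "f v \<le> norm v" for v
    using f(2)[of v] norm_triangle_ineq[of x v] by simp
  have abs: "\<bar>f v\<bar> \<le> norm v" for v
    using le[of v] le[of "- v"] linear_neg[OF f(1), of v] by simp
  have bl: "bounded_linear f"
    using f(1) abs by (auto simp: linear_iff intro!: bounded_linear_intro[where K=1])
  show ?thesis
  proof (rule that[of "Blinfun f"])
    show "norm (Blinfun f) \<le> 1"
      using abs by (intro norm_blinfun_bound) (auto simp: bounded_linear_Blinfun_apply[OF bl])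
    show "blinfun_apply (Blinfun f) x = norm x"
      using f(2)[of "- x"] le[of x] linear_neg[OF f(1), of x]
      by (simp add: bounded_linear_Blinfun_apply[OF bl])
  qed
qed

text \<open>By Baire's theorem one of the closed sets \<open>T n\<close> contains a ball.
  Subtracting the values at its centre \<open>x\<close> from those at \<open>x + z\<close> bounds
  all functionals by \<open>2 * n\<close> on vectors of norm \<open>e\<close>.\<close>

lemma uniform_boundedness:
  fixes F :: "('a::banach \<Rightarrow>\<^sub>L real) set"
  assumes pw: "\<And>x. \<exists>B. \<forall>f\<in>F. \<bar>blinfun_apply f x\<bar> \<le> B"
  obtains M where "\<And>f. f \<in> F \<Longrightarrow> norm f \<le> M"
proof -
  define T where "T n = {x. \<forall>f\<in>F. \<bar>blinfun_apply f x\<bar> \<le> real n}" for n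
  have cl: "closed (T n)" for n
  proof -
    have "T n = (\<Inter>f\<in>F. {x. \<bar>blinfun_apply f x\<bar> \<le> real n})" by (auto simp: T_def)
    also have "closed \<dots>"
      by (intro closed_INT ballI closed_Collect_le continuous_intros)
    finally show ?thesis .
  qed
  have "\<Union>(range T) = UNIV"
  proof -
    have "\<exists>n. x \<in> T n" for x
    proof -
      obtain B where "\<forall>f\<in>F. \<bar>blinfun_apply f x\<bar> \<le> B" using pw by blast
      moreover obtain n :: nat where "B \<le> n" using real_arch_simple by blast
      ultimately have "x \<in> T n" unfolding T_def by fastforce
      then show ?thesis by blast
    qed
    then show ?thesis by blast
  qed
  have "\<exists>n. interior (T n) \<noteq> {}"
  proof (rule ccontr)
    assume "\<not> ?thesis"
    then have "euclidean interior_of \<Union>(range T) = {}"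
      using cl by (intro Baire_category_alt) (auto simp: completely_metrizable_space_euclidean)
    then show False using \<open>\<Union>(range T) = UNIV\<close> by simp
  qed
  then obtain n x where "x \<in> interior (T n)" by blast
  then obtain e where e: "e > 0" "cball x e \<subseteq> T n" by (meson mem_interior_cball)
  show ?thesis
  proof (rule that)
    fix f assume f: "f \<in> F"
    show "norm f \<le> 2 * real n / e"
    proof (rule norm_blinfun_bound)
      show "0 \<le> 2 * real n / e" using e by simp
      fix y
      show "norm (blinfun_apply f y) \<le> 2 * real n / e * norm y"
      proof (cases "y = 0")
        case False
        define z where "z = (e / norm y) *\<^sub>R y"
        have "norm z = e" using False e by (simp add: z_def)
        then have "x \<in> T n" "x + z \<in> T n" using e by (auto simp: dist_norm subset_iff)
        then have "\<bar>blinfun_apply f x\<bar> \<le> real n" "\<bar>blinfun_apply f (x + z)\<bar> \<le> real n"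
          using f by (auto simp: T_def)
        then have "\<bar>blinfun_apply f z\<bar> \<le> 2 * real n" by (simp add: blinfun.add_right)
        then show ?thesis using False e by (simp add: z_def blinfun.scaleR_right abs_mult field_simps)
      qed (simp add: blinfun.zero_right)
    qed
  qed
qed

subsection \<open>A minimax theorem for affine functions\<close>

text \<open>Induction on the index set. On the part \<open>K'\<close> of \<open>K\<close> where
  \<open>f j\<close> is nonnegative the induction hypothesis gives a negative combination
  \<open>h\<close>, so the compact convex image of \<open>K\<close> under \<open>(h, f j)\<close>
  misses the closed quadrant. Separation in the plane then provides the weights of \<open>h\<close>
  and \<open>f j\<close>.\<close>

lemma affine_minimax_finite:
  fixes T :: "'a::real_vector topology" and f :: "'i \<Rightarrow> 'a \<Rightarrow> real"
  assumes "finite I" "compactin T K" "convex K" "K \<noteq> {}"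
    and "\<And>i. i \<in> I \<Longrightarrow> continuous_map T euclideanreal (f i)"
    and "\<And>i x y t. i \<in> I \<Longrightarrow> f i ((1 - t) *\<^sub>R x + t *\<^sub>R y) = (1 - t) * f i x + t * f i y"
    and "\<not> (\<exists>x\<in>K. \<forall>i\<in>I. f i x \<ge> 0)"
  shows "\<exists>c. (\<forall>i\<in>I. c i \<ge> 0) \<and> sum c I = 1 \<and> (\<forall>x\<in>K. (\<Sum>i\<in>I. c i * f i x) < 0)"
  using assms
proof (induction I arbitrary: K rule: finite_induct)
  case empty
  then show ?case by auto
next
  case (insert j I)
  have cont: "continuous_map T euclideanreal (f i)" if "i \<in> insert j I" for i
    using insert.prems(4) that by blast
  have aff: "f i ((1 - t) *\<^sub>R x + t *\<^sub>R y) = (1 - t) * f i x + t * f i y" if "i \<in> insert j I" for i x y t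
    using insert.prems(5) that by blast
  define K' where "K' = K \<inter> {x \<in> topspace T. f j x \<in> {0..}}"
  have KT: "K \<subseteq> topspace T" using insert.prems(1) by (rule compactin_subset_topspace)
  show ?case
  proof (cases "K' = {}")
    case True
    then have neg: "f j x < 0" if "x \<in> K" for x
      using that KT by (force simp: K'_def)
    define c where "c i = (if i = j then 1 else 0 :: real)" for i
    have 0: "c i = 0" if "i \<in> I" for i using that insert.hyps by (auto simp: c_def)
    have "sum c (insert j I) = 1" using insert.hyps by (simp add: 0) (simp add: c_def)
    moreover have "(\<Sum>i\<in>insert j I. c i * f i x) = f j x" for x
      using insert.hyps by (simp add: 0) (simp add: c_def)
    ultimately show ?thesis
      using neg by (intro exI[of _ c]) (auto simp: c_def)
  next
    case False
    have "closedin T {x \<in> topspace T. f j x \<in> {0..}}"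
      using cont[of j] by (intro closedin_continuous_map_preimage[of _ euclideanreal]) auto
    then have 1: "compactin T K'"
      unfolding K'_def using insert.prems(1) by (subst Int_commute) (rule closed_Int_compactin)
    have 2: "convex K'"
      unfolding convex_alt
    proof (intro ballI allI impI)
      fix x y and u :: real assume *: "x \<in> K'" "y \<in> K'" "0 \<le> u \<and> u \<le> 1"
      then have "(1 - u) *\<^sub>R x + u *\<^sub>R y \<in> K"
        using insert.prems(2) by (auto simp: K'_def convex_alt)
      then show "(1 - u) *\<^sub>R x + u *\<^sub>R y \<in> K'"
        using * aff[of j u x y] KT by (auto simp: K'_def)
    qed
    have 3: "\<not> (\<exists>x\<in>K'. \<forall>i\<in>I. 0 \<le> f i x)"
      using insert.prems(6) by (auto simp: K'_def)
    obtain c where c: "\<And>i. i \<in> I \<Longrightarrow> c i \<ge> 0" "sum c I = 1" "\<And>x. x \<in> K' \<Longrightarrow> (\<Sum>i\<in>I. c i * f i x) < 0"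
      using insert.IH[OF 1 2 False cont aff 3] by auto
    define h where "h x = (\<Sum>i\<in>I. c i * f i x)" for x
    have h_cont: "continuous_map T euclideanreal h"
      unfolding h_def using insert.hyps cont
      by (intro continuous_map_sum continuous_map_real_mult continuous_map_const[THEN iffD2]) auto
    have h_aff: "h ((1 - t) *\<^sub>R x + t *\<^sub>R y) = (1 - t) * h x + t * h y" for x y t
    proof -
      have "h ((1 - t) *\<^sub>R x + t *\<^sub>R y) = (\<Sum>i\<in>I. (1 - t) * (c i * f i x) + t * (c i * f i y))"
        unfolding h_def by (intro sum.cong refl) (simp add: aff distrib_left)
      then show ?thesis by (simp add: h_def sum.distrib sum_distrib_left)
    qed
    define P where "P = (\<lambda>x. (h x, f j x)) ` K"
    have "continuous_map T (prod_topology euclideanreal euclideanreal) (\<lambda>x. (h x, f j x))"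
      using h_cont cont[of j] by (intro continuous_map_pairedI) auto
    then have "compactin (prod_topology euclideanreal euclideanreal) P"
      unfolding P_def using insert.prems(1) by (rule image_compactin[rotated])
    then have P1: "compact P" by simp
    have P2: "convex P"
      unfolding convex_alt
    proof (intro ballI allI impI)
      fix p q and u :: real assume *: "p \<in> P" "q \<in> P" "0 \<le> u \<and> u \<le> 1"
      then obtain x y where xy: "x \<in> K" "y \<in> K" "p = (h x, f j x)" "q = (h y, f j y)"
        by (auto simp: P_def)
      have "(1 - u) *\<^sub>R x + u *\<^sub>R y \<in> K"
        using xy * insert.prems(2) by (auto simp: convex_alt)
      moreover have "(1 - u) *\<^sub>R p + u *\<^sub>R q = (h ((1 - u) *\<^sub>R x + u *\<^sub>R y), f j ((1 - u) *\<^sub>R x + u *\<^sub>R y))"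
        using xy by (simp add: h_aff aff)
      ultimately show "(1 - u) *\<^sub>R p + u *\<^sub>R q \<in> P" by (auto simp: P_def)
    qed
    have P3: "P \<noteq> {}" using insert.prems(3) by (simp add: P_def)
    define Q :: "(real \<times> real) set" where "Q = {0..} \<times> {0..}"
    have Q: "convex Q" "closed Q"
      by (auto simp: Q_def intro: convex_Times closed_Times)
    have "P \<inter> Q = {}"
    proof -
      have False if "x \<in> K" "h x \<ge> 0" "f j x \<ge> 0" for x
        using c(3)[of x] that KT by (auto simp: K'_def h_def)
      then show ?thesis by (auto simp: P_def Q_def)
    qed
    then obtain a b where ab: "\<And>p. p \<in> P \<Longrightarrow> inner a p < b" "\<And>p. p \<in> Q \<Longrightarrow> b < inner a p"
      using separating_hyperplane_compact_closed[OF P2 P1 P3 Q] by blast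
    obtain a1 a2 where a: "a = (a1, a2)" by (cases a)
    have b: "b < 0" using ab(2)[of "(0,0)"] by (simp add: Q_def a)
    \<comment> \<open>An affine bound on a half-line forces a nonnegative slope: a negative
      \<open>r\<close> would fail at \<open>n = b / r\<close>, which is positive as
      \<open>b < 0\<close>.\<close>
    have nn: "r \<ge> 0" if "\<And>n. n \<ge> 0 \<Longrightarrow> b < r * n" for r
    proof (rule ccontr)
      assume r: "\<not> r \<ge> 0"
      then have "b < r * (b / r)" using b by (intro that) (simp add: divide_nonpos_neg)
      then show False using r by simp
    qed
    have a1: "a1 \<ge> 0" using ab(2)[of "(_,0)"] by (intro nn) (auto simp: Q_def a)
    have a2: "a2 \<ge> 0" using ab(2)[of "(0,_)"] by (intro nn) (auto simp: Q_def a)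
    have lt: "a1 * h x + a2 * f j x < 0" if "x \<in> K" for x
      using ab(1)[of "(h x, f j x)"] that b by (auto simp: P_def a)
    have pos: "a1 + a2 > 0"
    proof (rule ccontr)
      assume "\<not> ?thesis"
      then have "a1 = 0" "a2 = 0" using a1 a2 by auto
      then show False using lt insert.prems(3) by auto
    qed
    \<comment> \<open>The separating weights are normalised so that the combination becomes
      \<open>(a1 * h x + a2 * f j x) / (a1 + a2)\<close>.\<close>
    define d where "d i = (if i = j then a2 else a1 * c i) / (a1 + a2)" for i
    have dI: "d i = a1 / (a1 + a2) * c i" if "i \<in> I" for i
      using that insert.hyps by (auto simp: d_def)
    have "sum d I = (\<Sum>i\<in>I. a1 / (a1 + a2) * c i)" using dI by (rule sum.cong[OF refl])
    also have "\<dots> = a1 / (a1 + a2)" by (simp only: sum_distrib_left[symmetric] c(2) mult_1_right)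
    finally have "sum d (insert j I) = 1"
      using insert.hyps pos by (simp add: d_def add_divide_distrib[symmetric])
    moreover have "(\<Sum>i\<in>insert j I. d i * f i x) < 0" if "x \<in> K" for x
    proof -
      have "(\<Sum>i\<in>I. d i * f i x) = a1 / (a1 + a2) * h x"
        unfolding h_def sum_distrib_left using dI by (intro sum.cong) (auto simp: mult.assoc)
      then have "(\<Sum>i\<in>insert j I. d i * f i x) = (a1 * h x + a2 * f j x) / (a1 + a2)"
        using insert.hyps by (simp add: d_def add_divide_distrib)
      then show ?thesis using lt[OF that] pos by (simp add: divide_neg_pos)
    qed
    moreover have "\<forall>i\<in>insert j I. d i \<ge> 0"
      using a1 a2 c(1) by (auto simp: d_def)
    ultimately show ?thesis by blast
  qed
qed

text \<open>Compactness reduces the claim to finitely many of the closed sets \<open>S i\<close>; if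
  finitely many had no common point in \<open>K\<close>, the finite lemma would give a combination
  negative on all of \<open>K\<close>, against \<open>comb\<close>.\<close>

lemma affine_minimax:
  fixes T :: "'a::real_vector topology" and f :: "'i \<Rightarrow> 'a \<Rightarrow> real"
  assumes K: "compactin T K" "convex K" "K \<noteq> {}"
    and cont: "\<And>i. i \<in> J \<Longrightarrow> continuous_map T euclideanreal (f i)"
    and aff: "\<And>i x y t. i \<in> J \<Longrightarrow> f i ((1 - t) *\<^sub>R x + t *\<^sub>R y) = (1 - t) * f i x + t * f i y"
    and comb: "\<And>I c. finite I \<Longrightarrow> I \<subseteq> J \<Longrightarrow> (\<And>i. i \<in> I \<Longrightarrow> c i \<ge> 0) \<Longrightarrow> sum c I = 1 \<Longrightarrow>
        \<exists>x\<in>K. (\<Sum>i\<in>I. c i * f i x) \<ge> 0"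
  obtains x where "x \<in> K" "\<And>i. i \<in> J \<Longrightarrow> f i x \<ge> 0"
proof -
  define S where "S i = {x \<in> topspace T. f i x \<in> {0..}}" for i
  have "K \<inter> \<Inter>(S ` J) \<noteq> {}"
  proof (rule K(1)[unfolded compactin_fip, THEN conjunct2, rule_format], intro conjI ballI allI impI)
    fix C assume "C \<in> S ` J"
    then obtain i where "i \<in> J" "C = S i" by blast
    then show "closedin T C"
      unfolding S_def using closedin_continuous_map_preimage[OF cont, of i "{0..}"] by simp
  next
    fix \<F> assume "finite \<F> \<and> \<F> \<subseteq> S ` J"
    then obtain I where I: "I \<subseteq> J" "finite I" "\<F> = S ` I"
      by (meson finite_subset_image)
    have "\<exists>x\<in>K. \<forall>i\<in>I. f i x \<ge> 0"
    proof (rule ccontr)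
      assume "\<not> ?thesis"
      then obtain c where "\<forall>i\<in>I. c i \<ge> 0" "sum c I = 1" "\<forall>x\<in>K. (\<Sum>i\<in>I. c i * f i x) < 0"
        using affine_minimax_finite[OF I(2) K, of f] cont aff I(1) by blast
      then show False using comb[OF I(2,1), of c] by force
    qed
    then show "K \<inter> \<Inter>\<F> \<noteq> {}"
      using compactin_subset_topspace[OF K(1)] by (fastforce simp: I(3) S_def)
  qed
  then show ?thesis using that by (auto simp: S_def)
qed

subsection \<open>Quasidense monotone graphs\<close>

lemma young_real: "a * b \<le> a\<^sup>2 / 2 + b\<^sup>2 / (2::real)"
  using sum_squares_bound[of a b] by simp

text \<open>A functional need not attain its norm, so only a near minimiser is available. Without
  one, homogeneity would give the smaller bound \<open>norm U - e / r\<close> for the norm.\<close>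

lemma blinfun_near_minimum_on_ball:
  fixes U :: "'b::real_normed_vector \<Rightarrow>\<^sub>L real"
  assumes "r \<ge> 0" "e > 0"
  obtains z where "norm z \<le> r" "blinfun_apply U z \<le> - r * norm U + e"
proof (cases "r = 0")
  case True
  then show ?thesis using that[of 0] assms by simp
next
  case False
  then have r: "r > 0" using assms by simp
  have "\<exists>z. norm z \<le> r \<and> blinfun_apply U z \<le> - r * norm U + e"
  proof (rule ccontr)
    assume "\<not> ?thesis"
    then have gt: "- r * norm U + e < blinfun_apply U z" if "norm z \<le> r" for z
      using that by (meson not_le)
    have le: "- blinfun_apply U x \<le> (norm U - e / r) * norm x" for x
    proof (cases "x = 0")
      case False
      have "- r * norm U + e < blinfun_apply U ((r / norm x) *\<^sub>R x)"
        using False r by (intro gt) simp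
      then show ?thesis using False r by (simp add: blinfun.scaleR_right field_simps)
    qed simp
    have "norm U \<le> norm U - e / r"
    proof (rule norm_blinfun_bound)
      show "0 \<le> norm U - e / r" using gt[of 0] r by (simp add: field_simps)
      show "norm (blinfun_apply U x) \<le> (norm U - e / r) * norm x" for x
        using le[of x] le[of "- x"] by (simp add: blinfun.minus_right)
    qed
    then show False using r assms by (simp add: field_simps)
  qed
  then show ?thesis using that by blast
qed

lemma quasidenseD:
  fixes G :: "('a::real_normed_vector \<times> ('a \<Rightarrow>\<^sub>L real)) set"
  assumes "quasidense G" "G \<noteq> {}" "e > 0"
  obtains s s' where "(s, s') \<in> G"
    "norm (s - x)^2 / 2 + norm (s' - x')^2 / 2 + blinfun_apply (s' - x') (s - x) < e"
proof -
  have "(INF p\<in>G. norm (fst p - x)^2 / 2 + norm (snd p - x')^2 / 2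
                         + blinfun_apply (snd p - x') (fst p - x)) < e"
    using assms by (simp add: quasidense_def) (meson le_less_trans)
  then obtain p where "p \<in> G" "norm (fst p - x)^2 / 2 + norm (snd p - x')^2 / 2
                         + blinfun_apply (snd p - x') (fst p - x) < e"
    using cInf_lessD[of "_ ` G"] assms(2) by (metis (no_types, lifting) image_iff image_is_empty)
  then show ?thesis using that[of "fst p" "snd p"] by simp
qed

text \<open>The relation \<open>rel\<close> makes the pairing term in quasidensity at
  \<open>(w, w')\<close> nonnegative, so the squared norms alone become arbitrarily small along
  \<open>G\<close>, and closedness applies.\<close>

lemma quasidense_maximal:
  fixes G :: "('a::real_normed_vector \<times> ('a \<Rightarrow>\<^sub>L real)) set"
  assumes G: "closed G" "quasidense G" "G \<noteq> {}"
    and rel: "\<And>t t'. (t, t') \<in> G \<Longrightarrow> blinfun_apply (t' - w') (t - w) \<ge> 0"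
  shows "(w, w') \<in> G"
proof -
  have "\<exists>p\<in>G. dist p (w, w') < e" if e: "e > 0" for e
  proof -
    obtain s s' where s: "(s, s') \<in> G"
      "norm (s - w)^2 / 2 + norm (s' - w')^2 / 2 + blinfun_apply (s' - w') (s - w) < e\<^sup>2 / 2"
      using quasidenseD[OF G(2,3), of "e\<^sup>2 / 2" w w'] e by auto
    have "norm (s - w)^2 + norm (s' - w')^2 < e\<^sup>2"
      using s(2) rel[OF s(1)] by linarith
    then have "dist (s, s') (w, w') < e"
      using e by (simp add: dist_norm norm_Pair real_less_lsqrt)
    then show ?thesis using s(1) by blast
  qed
  then show ?thesis using closed_approachable[OF G(1)] by blast
qed

text \<open>If \<open>g\<close> is convex and \<open>h f\<close> is its conjugate at \<open>- f\<close>, a pair \<open>(x, x')\<close> with \<open>g x + h x' + x' x \<le> 0\<close>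
  satisfies \<open>- x' \<in> \<partial>g x\<close>; so the conclusion says that the inclusion \<open>0 \<in> S x + \<partial>g x\<close> has bounded
  approximate solutions.\<close>

lemma quasidense_approximate_inclusion:
  fixes G :: "('a::real_normed_vector \<times> ('a \<Rightarrow>\<^sub>L real)) set"
    and g :: "'a \<Rightarrow> real" and h :: "('a \<Rightarrow>\<^sub>L real) \<Rightarrow> real"
  assumes ne: "G \<noteq> {}" and mono: "monotone_graph G" and qd: "quasidense G"
    and g: "convex_on UNIV g" "\<And>R. \<exists>B. \<forall>x. norm x \<le> R \<longrightarrow> g x \<le> B"
    and h: "convex_on UNIV h" "\<And>R. \<exists>B. \<forall>f. norm f \<le> R \<longrightarrow> h f \<le> B"
    and fenchel: "\<And>x f. - blinfun_apply f x \<le> g x + h f"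
    and tight: "\<And>u e. e > 0 \<Longrightarrow> \<exists>x. g x + blinfun_apply u x + h u \<le> e"
    and coercive: "\<And>r. r \<ge> 0 \<Longrightarrow> \<exists>C. \<forall>x f. r * (norm x + norm f) - C \<le> g x + h f"
  shows "\<exists>R. \<forall>e>0. e \<le> 1 \<longrightarrow> (\<exists>x x' s s'. (s, s') \<in> G \<and> norm x \<le> R \<and> norm x' \<le> R \<and>
      norm (s - x) \<le> e \<and> norm (s' - x') \<le> e \<and> g x + h x' + blinfun_apply x' x \<le> e)"
proof -
  \<comment> \<open>\<open>H\<close> lies in the epigraph of the largest convex minorant of the duality product restricted to \<open>G\<close>.\<close>
  define H where "H = convex hull ((\<lambda>p. (p, blinfun_apply (snd p) (fst p))) ` G)"
  define k where "k c = g (fst c) + h (snd c)" for c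
  have k: "k ((1 - t) *\<^sub>R c + t *\<^sub>R d) \<le> (1 - t) * k c + t * k d" if "0 \<le> t" "t \<le> 1" for t c d
    using convex_onD[OF g(1) that, of "fst c" "fst d"] convex_onD[OF h(1) that, of "snd c" "snd d"]
    by (simp add: k_def algebra_simps)
  have GH: "((s, s'), blinfun_apply s' s) \<in> H" if "(s, s') \<in> G" for s s'
  proof -
    have "((s, s'), blinfun_apply s' s) \<in> (\<lambda>p. (p, blinfun_apply (snd p) (fst p))) ` G"
      using that by (force simp: image_iff)
    then show ?thesis unfolding H_def by (rule hull_inc)
  qed
  have Hconv: "(1 - t) *\<^sub>R p + t *\<^sub>R q \<in> H" if "p \<in> H" "q \<in> H" "0 \<le> t" "t \<le> 1" for p q t
    using that convex_convex_hull unfolding H_def convex_alt by blast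
  \<comment> \<open>Monotonicity against \<open>(t, t')\<close> expands to an affine function lying
    below the duality product on \<open>G\<close>. Its epigraph \<open>S\<close> is convex and
    therefore contains \<open>H\<close>.\<close>
  have H_lb: "blinfun_apply t' x + blinfun_apply f t - blinfun_apply t' t \<le> r"
    if "((x, f), r) \<in> H" "(t, t') \<in> G" for x f r t t'
  proof -
    define S where "S = {p. blinfun_apply t' (fst (fst p)) + blinfun_apply (snd (fst p)) t
      - blinfun_apply t' t \<le> snd p}"
    have "convex S"
      unfolding convex_alt
    proof (intro ballI allI impI)
      fix p q and u :: real assume *: "p \<in> S" "q \<in> S" "0 \<le> u \<and> u \<le> 1"
      let ?l = "\<lambda>p. blinfun_apply t' (fst (fst p)) + blinfun_apply (snd (fst p)) t - blinfun_apply t' t"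
      have "?l ((1 - u) *\<^sub>R p + u *\<^sub>R q) = (1 - u) * ?l p + u * ?l q"
        by (simp add: blinfun.bilinear_simps algebra_simps)
      also have "\<dots> \<le> (1 - u) * snd p + u * snd q"
        using * by (intro add_mono mult_left_mono) (auto simp: S_def)
      finally show "(1 - u) *\<^sub>R p + u *\<^sub>R q \<in> S" by (simp add: S_def)
    qed
    moreover have "(\<lambda>p. (p, blinfun_apply (snd p) (fst p))) ` G \<subseteq> S"
    proof -
      have "blinfun_apply (s' - t') (s - t) \<ge> 0" if "(s, s') \<in> G" for s s'
        using mono that \<open>(t, t') \<in> G\<close> by (auto simp: monotone_graph_def)
      then show ?thesis by (force simp: S_def blinfun.bilinear_simps)
    qed
    ultimately have "H \<subseteq> S" unfolding H_def by (rule hull_minimal[rotated])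
    then show ?thesis using that(1) by (auto simp: S_def)
  qed
  obtain t0 t0' where t0: "(t0, t0') \<in> G" using ne by auto
  define N where "N = norm t0 + norm t0'"
  define q0 where "q0 = blinfun_apply t0' t0"
  have r_lb: "- N * (norm x + norm f) - q0 \<le> r" if "((x, f), r) \<in> H" for x f r
  proof -
    have 1: "\<bar>blinfun_apply t0' x\<bar> \<le> norm t0' * norm x" "\<bar>blinfun_apply f t0\<bar> \<le> norm f * norm t0"
      using norm_blinfun[of t0' x] norm_blinfun[of f t0] by simp_all
    have 2: "norm t0' * norm x \<le> N * norm x" "norm f * norm t0 \<le> N * norm f"
      by (simp_all add: N_def algebra_simps)
    have "- N * (norm x + norm f) = - (N * norm x) - N * norm f" by (simp add: algebra_simps)
    then show ?thesis using H_lb[OF that t0] 1 2 unfolding q0_def by linarith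
  qed
  have N: "N \<ge> 0" by (simp add: N_def)
  \<comment> \<open>By \<open>r_lb\<close> the third coordinate of a point of \<open>H\<close>
    decreases at most with slope \<open>N\<close>; coercivity with the same slope compensates for
    this, so the infimum defining \<open>m\<close> is finite.\<close>
  have lbk: "\<exists>C. \<forall>p\<in>H. C \<le> k (fst p + v) + snd p" for v
  proof -
    obtain C where C: "\<And>x f. N * (norm x + norm f) - C \<le> g x + h f" using coercive[OF N] by blast
    have "- N * (norm (fst v) + norm (snd v)) - C - q0 \<le> k (fst p + v) + snd p" if "p \<in> H" for p
    proof -
      obtain x f r where p: "p = ((x, f), r)" by (metis surj_pair)
      have "norm x \<le> norm (x + fst v) + norm (fst v)" "norm f \<le> norm (f + snd v) + norm (snd v)"
        using norm_triangle_ineq4[of "x + fst v" "fst v"] norm_triangle_ineq4[of "f + snd v" "snd v"] by simp_all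
      then have "N * (norm x + norm f) \<le> N * ((norm (x + fst v) + norm (f + snd v)) + (norm (fst v) + norm (snd v)))"
        using N by (intro mult_left_mono) linarith+
      then show ?thesis using C[of "x + fst v" "f + snd v"] r_lb[of x f r] that
        unfolding p by (simp add: k_def distrib_left)
    qed
    then show ?thesis by blast
  qed
  have Hne: "H \<noteq> {}" using GH[OF t0] by blast
  \<comment> \<open>This is the value function of minimising \<open>k\<close> plus the height over
    \<open>H\<close>, with \<open>k\<close> shifted by \<open>v\<close>; a subgradient at 0 is a
    dual solution.\<close>
  define m where "m v = (INF p\<in>H. k (fst p + v) + snd p)" for v
  have m_le: "m v \<le> k (fst p + v) + snd p" if "p \<in> H" for p v
    unfolding m_def using lbk[of v] by (intro cINF_lower[OF _ that]) (auto simp: bdd_below_def)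
  have m_ge: "b \<le> m v" if "\<And>p. p \<in> H \<Longrightarrow> b \<le> k (fst p + v) + snd p" for b v
    unfolding m_def by (rule cINF_greatest[OF Hne that])
  have "convex_on UNIV m"
  proof (rule convex_onI)
    fix t v w assume t: "(0::real) < t" "t < 1"
    have 1: "m ((1 - t) *\<^sub>R v + t *\<^sub>R w) \<le> (1 - t) * (k (fst p + v) + snd p) + t * (k (fst q + w) + snd q)"
      if "p \<in> H" "q \<in> H" for p q
    proof -
      have "m ((1 - t) *\<^sub>R v + t *\<^sub>R w) \<le> k (fst ((1 - t) *\<^sub>R p + t *\<^sub>R q) + ((1 - t) *\<^sub>R v + t *\<^sub>R w))
          + snd ((1 - t) *\<^sub>R p + t *\<^sub>R q)"
        using that t by (intro m_le Hconv) auto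
      also have "fst ((1 - t) *\<^sub>R p + t *\<^sub>R q) + ((1 - t) *\<^sub>R v + t *\<^sub>R w) =
          (1 - t) *\<^sub>R (fst p + v) + t *\<^sub>R (fst q + w)"
        by (simp add: scaleR_add_right)
      also have "k \<dots> \<le> (1 - t) * k (fst p + v) + t * k (fst q + w)"
        using t by (intro k) auto
      finally show ?thesis by (simp add: algebra_simps)
    qed
    \<comment> \<open>The infimum over \<open>p\<close> is taken first with \<open>q\<close> fixed,
      then the one over \<open>q\<close>.\<close>
    have 2: "m ((1 - t) *\<^sub>R v + t *\<^sub>R w) \<le> (1 - t) * m v + t * (k (fst q + w) + snd q)" if "q \<in> H" for q
    proof -
      have "(m ((1 - t) *\<^sub>R v + t *\<^sub>R w) - t * (k (fst q + w) + snd q)) / (1 - t) \<le> m v"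
      proof (rule m_ge)
        fix p assume "p \<in> H"
        from 1[OF this that] t
        show "(m ((1 - t) *\<^sub>R v + t *\<^sub>R w) - t * (k (fst q + w) + snd q)) / (1 - t) \<le> k (fst p + v) + snd p"
          by (subst pos_divide_le_eq) (auto simp: mult.commute)
      qed
      then show ?thesis using t by (subst (asm) pos_divide_le_eq) (auto simp: mult.commute)
    qed
    have "(m ((1 - t) *\<^sub>R v + t *\<^sub>R w) - (1 - t) * m v) / t \<le> m w"
    proof (rule m_ge)
      fix p assume "p \<in> H"
      from 2[OF this] t
      show "(m ((1 - t) *\<^sub>R v + t *\<^sub>R w) - (1 - t) * m v) / t \<le> k (fst p + w) + snd p"
        by (subst pos_divide_le_eq) (auto simp: mult.commute)
    qed
    then show "m ((1 - t) *\<^sub>R v + t *\<^sub>R w) \<le> (1 - t) * m v + t * m w"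
      using t by (subst (asm) pos_divide_le_eq) (auto simp: mult.commute)
  qed simp
  from ex_subgradient_at_zero[OF this]
  obtain L where L: "linear L" "\<And>v. m 0 + L v \<le> m v" by blast
  \<comment> \<open>Evaluating at the single point \<open>(t0, t0')\<close> and using that
    \<open>g\<close> and \<open>h\<close> are bounded on balls bounds \<open>m\<close>, hence
    \<open>L\<close>, above on the unit ball.\<close>
  have bl: "bounded_linear L"
  proof -
    obtain B where B: "\<And>x. norm x \<le> norm t0 + 1 \<Longrightarrow> g x \<le> B" using g(2) by blast
    obtain D where D: "\<And>f. norm f \<le> norm t0' + 1 \<Longrightarrow> h f \<le> D" using h(2) by blast
    have "L v \<le> B + D + q0 - m 0" if "norm v \<le> 1" for v
    proof -
      have "norm (fst v) \<le> 1" "norm (snd v) \<le> 1"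
        using that norm_fst_le[of "fst v" "snd v"] norm_snd_le[of "snd v" "fst v"] by auto
      then have "g (t0 + fst v) \<le> B" "h (t0' + snd v) \<le> D"
        by (auto intro!: B D intro: norm_triangle_le)
      moreover have "m v \<le> k ((t0, t0') + v) + q0"
        using m_le[OF GH[OF t0], of v] by (simp add: q0_def)
      ultimately show ?thesis using L(2)[of v] by (simp add: k_def)
    qed
    then show ?thesis by (rule bounded_linear_if_bounded_above[OF L(1)])
  qed
  define u where "u = Blinfun (\<lambda>x. L (x, 0))"
  define U where "U = Blinfun (\<lambda>f. L (0, f))"
  have u: "blinfun_apply u x = L (x, 0)" for x
    unfolding u_def
    by (subst bounded_linear_Blinfun_apply) (auto intro!: bounded_linear_compose[OF bl] bounded_linear_Pair bounded_linear_ident bounded_linear_zero)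
  have U: "blinfun_apply U f = L (0, f)" for f
    unfolding U_def
    by (subst bounded_linear_Blinfun_apply) (auto intro!: bounded_linear_compose[OF bl] bounded_linear_Pair bounded_linear_ident bounded_linear_zero)
  have L_eq: "L (x, f) = blinfun_apply u x + blinfun_apply U f" for x f
    using linear_add[OF L(1), of "(x, 0)" "(0, f)"] by (simp add: u U)
  text \<open>Fenchel duality gives \<open>m 0\<close> as a dual value at \<open>(u, U)\<close>, and quasidensity at \<open>(0, z - u)\<close>, where \<open>z\<close>
    almost realises \<open>norm U\<close>, bounds this value.\<close>
  have m0: "m 0 \<le> 3 * e" if e: "e > 0" for e
  proof -
    obtain z where z: "norm z \<le> norm U" "blinfun_apply U z \<le> - norm U * norm U + e"
      using blinfun_near_minimum_on_ball[of "norm U" e U] e by auto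
    define y where "y = z - u"
    obtain s s' where s: "(s, s') \<in> G"
      "norm s^2 / 2 + norm (s' - y)^2 / 2 + blinfun_apply (s' - y) s < e"
      using quasidenseD[OF qd ne e, of 0 y] by auto
    obtain x where x: "g x + blinfun_apply (- u) x + h (- u) \<le> e" using tight[OF e] by blast
    \<comment> \<open>The shift carries \<open>(s, s')\<close> to \<open>(x, - u)\<close>, where
      \<open>tight\<close> controls \<open>k\<close>.\<close>
    have "m 0 + L (x - s, - u - s') \<le> k (x, - u) + blinfun_apply s' s"
      using L(2)[of "(x - s, - u - s')"] m_le[OF GH[OF s(1)], of "(x - s, - u - s')"] by simp
    then have 1: "m 0 \<le> e + blinfun_apply u s + blinfun_apply U u + blinfun_apply U s' + blinfun_apply s' s"
      using x by (simp add: L_eq k_def blinfun.bilinear_simps)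
    have 2: "blinfun_apply s' s = blinfun_apply (s' - y) s + blinfun_apply z s - blinfun_apply u s"
      by (simp add: y_def blinfun.bilinear_simps)
    have 3: "blinfun_apply U s' = blinfun_apply U (s' - y) + blinfun_apply U z - blinfun_apply U u"
      by (simp add: y_def blinfun.bilinear_simps)
    have "blinfun_apply z s \<le> norm z * norm s"
      using norm_blinfun[of z s] by simp
    also have "\<dots> \<le> norm U * norm s" using z(1) by (intro mult_right_mono) auto
    finally have 4: "blinfun_apply z s \<le> (norm U)\<^sup>2 / 2 + (norm s)\<^sup>2 / 2" using young_real[of "norm U" "norm s"] by linarith
    have "blinfun_apply U (s' - y) \<le> norm U * norm (s' - y)"
      using norm_blinfun[of U "s' - y"] by simp
    then have 5: "blinfun_apply U (s' - y) \<le> (norm U)\<^sup>2 / 2 + (norm (s' - y))\<^sup>2 / 2"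
      using young_real[of "norm U" "norm (s' - y)"] by linarith
    have 6: "blinfun_apply U z \<le> - (norm U)\<^sup>2 + e" using z(2) by (simp add: power2_eq_square)
    \<comment> \<open>The terms in \<open>norm U\<close> cancel and the quasidensity expression
      remains; the three errors \<open>e\<close> come from \<open>tight\<close>, from
      \<open>z\<close> and from quasidensity.\<close>
    show ?thesis using 1 2 3 4 5 6 s(2) by linarith
  qed
  have "m 0 \<le> 0"
    using m0[of "m 0 / 6"] by (rule_tac ccontr) simp
  \<comment> \<open>Slope \<open>N + 1\<close> exceeds the slope in \<open>r_lb\<close> by one, so a
    bound on \<open>g x + h f + r\<close> bounds \<open>norm x + norm f\<close>.\<close>
  obtain C where C: "\<And>x f. (N + 1) * (norm x + norm f) - C \<le> g x + h f"
    using coercive[of "N + 1"] N by auto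
  show ?thesis
  proof (intro exI[of _ "1 + C + q0"] allI impI)
    fix e :: real assume e: "e > 0" "e \<le> 1"
    \<comment> \<open>Each half square is below \<open>2 * d\<close>, hence each norm is at most
      \<open>e\<close>, while \<open>2 * d \<le> e\<close> because \<open>e \<le> 1\<close>.\<close>
    define d where "d = e\<^sup>2 / 4"
    have d: "d > 0" "2 * d \<le> e" "d \<le> 1"
      using e power_decreasing[of 1 2 e] by (auto simp: d_def)
    have "\<exists>p\<in>H. k (fst p) + snd p < d"
    proof (rule ccontr)
      assume "\<not> ?thesis"
      then have "d \<le> m 0" by (intro m_ge) (simp add: not_less)
      then show False using \<open>m 0 \<le> 0\<close> d by simp
    qed
    then obtain x f r where p: "((x, f), r) \<in> H" "g x + h f + r < d"
      by (auto simp: k_def)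
    obtain s s' where s: "(s, s') \<in> G"
      "norm (s - x)^2 / 2 + norm (s' - f)^2 / 2 + blinfun_apply (s' - f) (s - x) < d"
      using quasidenseD[OF qd ne d(1)] by blast
    \<comment> \<open>This is \<open>H_lb\<close> against the nearby point of \<open>G\<close>; with
      the Fenchel inequality it keeps the pairing term above \<open>- d\<close>.\<close>
    have 1: "blinfun_apply f x - r \<le> blinfun_apply (s' - f) (s - x)"
      using H_lb[OF p(1) s(1)] by (simp add: blinfun.bilinear_simps)
    have 2: "- d < blinfun_apply (s' - f) (s - x)"
      using 1 p(2) fenchel[of f x] by linarith
    have sq: "norm (s - x)^2 \<le> e\<^sup>2" "norm (s' - f)^2 \<le> e\<^sup>2"
      using s(2) 2 zero_le_power2[of "norm (s - x)"] zero_le_power2[of "norm (s' - f)"]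
      unfolding d_def by linarith+
    have "norm (s - x) \<le> e" "norm (s' - f) \<le> e"
      using sq e by (auto intro: power2_le_imp_le)
    moreover have "g x + h f + blinfun_apply f x \<le> e"
      using 1 p(2) s(2) d(2) zero_le_power2[of "norm (s - x)"] zero_le_power2[of "norm (s' - f)"]
      by linarith
    moreover have "norm x + norm f \<le> 1 + C + q0"
      using C[of x f] r_lb[OF p(1)] p(2) d(3) by (simp add: algebra_simps)
    then have "norm x \<le> 1 + C + q0" "norm f \<le> 1 + C + q0"
      using norm_ge_zero[of x] norm_ge_zero[of f] by linarith+
    ultimately show "\<exists>x x' s s'. (s, s') \<in> G \<and> norm x \<le> 1 + C + q0 \<and> norm x' \<le> 1 + C + q0 \<and>
      norm (s - x) \<le> e \<and> norm (s' - x') \<le> e \<and> g x + h x' + blinfun_apply x' x \<le> e"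
      using s(1) by blast
  qed
qed

subsection \<open>Support functions of compact convex sets\<close>

text \<open>Both orders of the pairing between a space and its dual are instances; the norming
  conditions are approximate for the reason that norms of functionals need not be attained.\<close>

locale normed_pairing =
  fixes B :: "'v::real_normed_vector \<Rightarrow> 'x::real_normed_vector \<Rightarrow> real"
  assumes bilinear: "bounded_bilinear B"
    and bound: "\<bar>B y x\<bar> \<le> norm y * norm x"
    and norming_left: "r \<ge> 0 \<Longrightarrow> e > 0 \<Longrightarrow> \<exists>y. norm y \<le> r \<and> B y x \<le> - r * norm x + e"
    and norming_right: "r \<ge> 0 \<Longrightarrow> e > 0 \<Longrightarrow> \<exists>x. norm x \<le> r \<and> B y x \<le> - r * norm y + e"

lemma convex_on_half_norm_square: "convex_on UNIV (\<lambda>x::'a::real_normed_vector. (norm x)\<^sup>2 / 2)"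
proof (rule convex_onI)
  fix t :: real and x y :: 'a assume t: "0 < t" "t < 1"
  have "norm ((1 - t) *\<^sub>R x + t *\<^sub>R y) \<le> (1 - t) * norm x + t * norm y"
    using t by (intro norm_triangle_le) simp
  then have "(norm ((1 - t) *\<^sub>R x + t *\<^sub>R y))\<^sup>2 \<le> ((1 - t) * norm x + t * norm y)\<^sup>2"
    by (intro power_mono) auto
  also have "\<dots> = (1 - t) * (norm x)\<^sup>2 + t * (norm y)\<^sup>2 - t * (1 - t) * (norm x - norm y)\<^sup>2"
    by (simp add: power2_eq_square algebra_simps)
  also have "\<dots> \<le> (1 - t) * (norm x)\<^sup>2 + t * (norm y)\<^sup>2"
    using t by simp
  finally show "(norm ((1 - t) *\<^sub>R x + t *\<^sub>R y))\<^sup>2 / 2 \<le> (1 - t) * ((norm x)\<^sup>2 / 2) + t * ((norm y)\<^sup>2 / 2)"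
    by simp
qed simp

text \<open>\<open>T\<close> stands for the weak or the weak-star topology, and the norm bound
  \<open>M\<close> will come from uniform boundedness.\<close>

locale compact_support = normed_pairing B
  for B :: "'v::real_normed_vector \<Rightarrow> 'x::real_normed_vector \<Rightarrow> real" +
  fixes T :: "'x topology" and W :: "'x set" and M :: real
  assumes W: "compactin T W" "convex W" "W \<noteq> {}"
    and cont: "continuous_map T euclideanreal (B y)"
    and W_bound: "w \<in> W \<Longrightarrow> norm w \<le> M"
begin

lemmas B_simps = bounded_bilinear.add_left[OF bilinear] bounded_bilinear.add_right[OF bilinear]
  bounded_bilinear.diff_left[OF bilinear] bounded_bilinear.diff_right[OF bilinear]
  bounded_bilinear.scaleR_left[OF bilinear] bounded_bilinear.scaleR_right[OF bilinear]
  bounded_bilinear.zero_left[OF bilinear] bounded_bilinear.zero_right[OF bilinear]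
  bounded_bilinear.minus_left[OF bilinear] bounded_bilinear.minus_right[OF bilinear]

text \<open>\<open>p\<close> is the support function of \<open>- W\<close>, and \<open>h x\<close> is the conjugate of \<open>g\<close> at \<open>- x\<close>.\<close>

definition p :: "'v \<Rightarrow> real" where "p y = (SUP x\<in>W. - B y x)"

definition g :: "'v \<Rightarrow> real" where "g y = p y + (norm y)\<^sup>2 / 2"

definition h :: "'x \<Rightarrow> real" where "h x = (SUP y. - B y x - g y)"

lemma p_attained:
  obtains w where "w \<in> W" "p y = - B y w" "\<And>x. x \<in> W \<Longrightarrow> - B y x \<le> p y"
proof -
  have "compact (B y ` W)"
    using image_compactin[OF W(1) cont] by simp
  then obtain w where w: "w \<in> W" "\<And>x. x \<in> W \<Longrightarrow> B y w \<le> B y x"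
    using compact_attains_inf[of "B y ` W"] W(3) by auto
  have "p y = - B y w"
    unfolding p_def using w by (intro cSup_eq_maximum) auto
  then show ?thesis using that[of w] w by simp
qed

lemma p_ge: "x \<in> W \<Longrightarrow> - B y x \<le> p y"
  by (metis p_attained)

lemma p_sublinear: "sublinear p"
  unfolding sublinear_def
proof (intro conjI allI impI)
  fix y z
  obtain w where w: "w \<in> W" "p (y + z) = - B (y + z) w" by (metis p_attained)
  then show "p (y + z) \<le> p y + p z" using p_ge[OF w(1), of y] p_ge[OF w(1), of z] by (simp add: B_simps)
next
  fix t :: real and y assume t: "t > 0"
  obtain w where w: "w \<in> W" "p (t *\<^sub>R y) = - B (t *\<^sub>R y) w" by (metis p_attained)
  then show "p (t *\<^sub>R y) \<le> t * p y"
    using mult_left_mono[OF p_ge[OF w(1), of y], of t] t by (simp add: B_simps)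
qed

lemma p_le: "p y \<le> M * norm y"
proof -
  obtain w where w: "w \<in> W" "p y = - B y w" by (metis p_attained)
  have "- B y w \<le> norm y * norm w" using bound[of y w] by linarith
  also have "\<dots> \<le> norm y * M" using W_bound[OF w(1)] by (rule mult_left_mono) simp
  finally show ?thesis using w by (simp add: mult.commute)
qed

lemma p_lower: "- (M * norm y) \<le> p y"
  using sublinear_ge_minus[OF p_sublinear, of y] p_le[of "- y"] by simp

lemma p_diff_le: "p y \<le> p z + M * norm (y - z)"
  using sublinear_add[OF p_sublinear, of z "y - z"] p_le[of "y - z"] by simp

lemma M_nonneg: "M \<ge> 0"
  using W_bound W(3) norm_ge_zero order_trans by blast

lemma g_convex: "convex_on UNIV g"
proof -
  have "convex_on UNIV p"
  proof (rule convex_onI)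
    fix t :: real and x y assume t: "0 < t" "t < 1"
    show "p ((1 - t) *\<^sub>R x + t *\<^sub>R y) \<le> (1 - t) * p x + t * p y"
      using sublinear_add[OF p_sublinear, of "(1 - t) *\<^sub>R x" "t *\<^sub>R y"] t
      by (simp add: sublinear_scale[OF p_sublinear])
  qed simp
  then show ?thesis
    unfolding g_def by (intro convex_on_add convex_on_half_norm_square)
qed

lemma g_bounded: "\<exists>D. \<forall>y. norm y \<le> R \<longrightarrow> g y \<le> D"
proof (intro exI allI impI)
  fix y :: 'v assume y: "norm y \<le> R"
  then have "M * norm y \<le> M * R" "(norm y)\<^sup>2 \<le> R\<^sup>2"
    using M_nonneg by (auto intro: mult_left_mono power_mono)
  then show "g y \<le> M * R + R\<^sup>2 / 2" using p_le[of y] by (simp add: g_def)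
qed

text \<open>Young's inequality after splitting off \<open>w\<close>. It bounds \<open>h\<close> by
  half the squared distance to any point of \<open>W\<close>.\<close>

lemma conjugate_term_le:
  assumes "w \<in> W"
  shows "- B y x - g y \<le> (norm (x - w))\<^sup>2 / 2"
proof -
  have "- B y x - g y \<le> - B y (x - w) - (norm y)\<^sup>2 / 2"
    using p_ge[OF assms, of y] by (simp add: g_def B_simps)
  also have "\<dots> \<le> norm y * norm (x - w) - (norm y)\<^sup>2 / 2"
    using bound[of y "x - w"] by linarith
  also have "\<dots> \<le> (norm (x - w))\<^sup>2 / 2"
    using young_real[of "norm y" "norm (x - w)"] by linarith
  finally show ?thesis .
qed

lemma h_ge: "- B y x - g y \<le> h x"
proof -
  obtain w where "w \<in> W" using W(3) by blast
  then show ?thesis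
    unfolding h_def by (intro cSUP_upper bdd_aboveI2[OF conjugate_term_le]) auto
qed

lemma h_least: "(\<And>y. - B y x - g y \<le> b) \<Longrightarrow> h x \<le> b"
  unfolding h_def by (rule cSUP_least) auto

lemma h_le: "w \<in> W \<Longrightarrow> h x \<le> (norm (x - w))\<^sup>2 / 2"
  by (rule h_least) (rule conjugate_term_le)

lemma h_nonneg: "h x \<ge> 0"
  using h_ge[of 0 x] sublinear_zero[OF p_sublinear] by (simp add: g_def B_simps)

lemma h_convex: "convex_on UNIV h"
proof (rule convex_onI)
  fix t :: real and x z assume t: "0 < t" "t < 1"
  show "h ((1 - t) *\<^sub>R x + t *\<^sub>R z) \<le> (1 - t) * h x + t * h z"
  proof (rule h_least)
    fix y
    have "- B y ((1 - t) *\<^sub>R x + t *\<^sub>R z) - g y = (1 - t) * (- B y x - g y) + t * (- B y z - g y)"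
      by (simp add: B_simps algebra_simps)
    also have "\<dots> \<le> (1 - t) * h x + t * h z"
      using t h_ge[of y] by (intro add_mono mult_left_mono) auto
    finally show "- B y ((1 - t) *\<^sub>R x + t *\<^sub>R z) - g y \<le> (1 - t) * h x + t * h z" .
  qed
qed simp

lemma h_bounded: "\<exists>D. \<forall>x. norm x \<le> R \<longrightarrow> h x \<le> D"
proof -
  obtain w where w: "w \<in> W" using W(3) by blast
  have "h x \<le> (R + norm w)\<^sup>2 / 2" if "norm x \<le> R" for x
  proof -
    have "norm (x - w) \<le> R + norm w" using that norm_triangle_ineq4[of x w] by linarith
    then have "(norm (x - w))\<^sup>2 \<le> (R + norm w)\<^sup>2" by (intro power_mono) auto
    then show ?thesis using h_le[OF w, of x] by linarith
  qed
  then show ?thesis by blast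
qed

lemma fenchel_young: "- B y x \<le> g y + h x"
  using h_ge[of y x] by linarith

text \<open>Testing the conjugate at a \<open>z\<close> that nearly norms \<open>x\<close> gives
  \<open>h\<close> linear growth of slope \<open>r\<close>; in \<open>g\<close> the quadratic term
  absorbs any linear one.\<close>

lemma coercive:
  assumes "r \<ge> 0"
  shows "\<exists>C. \<forall>y x. r * (norm y + norm x) - C \<le> g y + h x"
proof (intro exI allI)
  fix y x
  obtain z where z: "norm z \<le> r" "B z x \<le> - r * norm x + 1" using norming_left[of r 1 x] assms by auto
  have "M * norm z \<le> M * r" "(norm z)\<^sup>2 \<le> r\<^sup>2"
    using M_nonneg z by (auto intro: mult_left_mono power_mono)
  then have 1: "r * norm x - 1 - M * r - r\<^sup>2 / 2 \<le> h x"
    using h_ge[of z x] z(2) p_le[of z] by (simp add: g_def)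
  have 2: "r * norm y - (M + r)\<^sup>2 / 2 \<le> g y"
    using p_lower[of y] young_real[of "M + r" "norm y"] by (simp add: g_def distrib_right)
  show "r * (norm y + norm x) - ((M + r)\<^sup>2 / 2 + 1 + M * r + r\<^sup>2 / 2) \<le> g y + h x"
    using 1 2 unfolding distrib_left by linarith
qed

lemma tight_left:
  assumes "e > 0"
  shows "\<exists>y. g y + B y x + h x \<le> e"
proof (rule ccontr)
  assume "\<not> ?thesis"
  then have "e < g y + B y x + h x" for y by (simp add: not_le)
  then have "h x \<le> h x - e" by (intro h_least) (smt (verit))
  then show False using assms by simp
qed

text \<open>The witness is \<open>w + z\<close>, where \<open>w\<close> attains \<open>p y\<close>
  and \<open>z\<close>, of norm at most \<open>norm y\<close>, nearly minimises \<open>B y\<close>.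
  The two half squares are then cancelled by \<open>- norm y * norm y\<close>.\<close>

lemma tight_right:
  assumes "e > 0"
  shows "\<exists>x. h x + B y x + g y \<le> e"
proof -
  obtain w where w: "w \<in> W" "p y = - B y w" by (metis p_attained)
  obtain z where z: "norm z \<le> norm y" "B y z \<le> - norm y * norm y + e"
    using norming_right[of "norm y" e y] assms by auto
  have "(norm z)\<^sup>2 \<le> (norm y)\<^sup>2" using z(1) by (intro power_mono) auto
  moreover have "h (w + z) \<le> (norm z)\<^sup>2 / 2" using h_le[OF w(1), of "w + z"] by simp
  ultimately have "h (w + z) \<le> (norm y)\<^sup>2 / 2" by linarith
  then have "h (w + z) + B y (w + z) + g y \<le> e"
    using w z(2) by (simp add: g_def B_simps power2_eq_square)
  then show ?thesis by blast
qed

text \<open>Test the conjugate at \<open>t *\<^sub>R y\<close> and divide by \<open>t\<close>. With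
  \<open>t\<close> and \<open>d / t\<close> both small, \<open>x\<close> nearly satisfies the
  inequalities valid for points of \<open>W\<close>.\<close>

lemma minus_le_support_if_conjugate_small:
  assumes "h x \<le> d" "t > 0"
  shows "- B y x \<le> p y + t * (norm y)\<^sup>2 / 2 + d / t"
proof -
  have "- B (t *\<^sub>R y) x \<le> p (t *\<^sub>R y) + (norm (t *\<^sub>R y))\<^sup>2 / 2 + d"
    using h_ge[of "t *\<^sub>R y" x] assms by (simp add: g_def)
  then have "t * (- B y x) \<le> t * (p y + t * (norm y)\<^sup>2 / 2 + d / t)"
    using assms by (simp add: B_simps sublinear_scale[OF p_sublinear] power_mult_distrib
        power2_eq_square algebra_simps)
  then show ?thesis using assms(2) by (simp only: mult_le_cancel_left_pos)
qed

lemma approximation_converges: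
  fixes \<Gamma> :: "('v \<times> 'x) set"
  assumes related: "\<And>y x. (y, x) \<in> \<Gamma> \<Longrightarrow> \<exists>w\<in>W. B y (x - w) \<ge> 0"
    and approx: "\<And>e. e > 0 \<Longrightarrow> e \<le> 1 \<Longrightarrow> \<exists>y x s s'. (s, s') \<in> \<Gamma> \<and> norm y \<le> R \<and> norm x \<le> R \<and>
        norm (s - y) \<le> e \<and> norm (s' - x) \<le> e \<and> g y + h x + B y x \<le> e"
    and d: "d > 0"
  shows "\<exists>(s, s')\<in>\<Gamma>. norm s \<le> d \<and> norm s' \<le> R + 1 \<and> - B v s' \<le> p v + d"
proof -
  \<comment> \<open>\<open>K\<close> collects the errors counted in \<open>eK\<close>: 1 from the
    approximate inclusion, \<open>R\<close> and \<open>R + 1\<close> from replacing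
    \<open>B y x\<close> by \<open>B s s'\<close>, and \<open>M\<close> from replacing
    \<open>p y\<close> by \<open>p s\<close>.\<close>
  define K where "K = 2 * R + 2 + M"
  have R: "R \<ge> 0" using approx[of 1] by (auto intro: order_trans[OF norm_ge_zero])
  have K: "K > 0" using R M_nonneg by (simp add: K_def)
  define t where "t = d / (3 * ((norm v)\<^sup>2 + 1))"
  have t: "t > 0" using d by (simp add: t_def add_nonneg_pos)
  have tv: "t * (norm v)\<^sup>2 / 2 \<le> d / 3"
  proof -
    have "t * (norm v)\<^sup>2 \<le> t * ((norm v)\<^sup>2 + 1)" using t by (intro mult_left_mono) auto
    also have "\<dots> = d / 3"
    proof -
      have "(norm v)\<^sup>2 + 1 \<noteq> 0" using zero_le_power2[of "norm v"] by linarith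
      moreover have "d / (3 * n) * n = d / 3" if "n \<noteq> 0" for n using that by simp
      ultimately show ?thesis unfolding t_def by blast
    qed
    finally show ?thesis using d by linarith
  qed
  \<comment> \<open>In order, the entries admit \<open>approx\<close>, bound
    \<open>norm (s - y)\<close> by \<open>d / 2\<close>, bound \<open>norm y\<close> by
    \<open>d / 2\<close>, and make \<open>e * K / t\<close> and the error
    \<open>- B v (s' - x)\<close> at most \<open>d / 3\<close>.\<close>
  define e where "e = Min {1, d / 2, (d / 2)\<^sup>2 / (2 * K), d * t / (3 * K), d / (3 * (norm v + 1))}"
  have e: "e \<le> 1" "e \<le> d / 2" "e \<le> (d / 2)\<^sup>2 / (2 * K)" "e \<le> d * t / (3 * K)" "e \<le> d / (3 * (norm v + 1))"
    unfolding e_def by (rule Min_le; simp)+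
  have e0: "e > 0"
    unfolding e_def using d t K by (subst Min_gr_iff) (auto simp: add_nonneg_pos)
  obtain y x s s' where *: "(s, s') \<in> \<Gamma>" "norm y \<le> R" "norm x \<le> R" "norm (s - y) \<le> e" "norm (s' - x) \<le> e"
      "g y + h x + B y x \<le> e"
    using approx[OF e0 e(1)] by blast
  have s: "norm s \<le> R + 1" using *(2,4) e(1) norm_triangle_ineq[of "s - y" y] by simp
  have s': "norm s' \<le> R + 1" using *(3,5) e(1) norm_triangle_ineq[of "s' - x" x] by simp
  obtain w where w: "w \<in> W" "B s (s' - w) \<ge> 0" using related[OF *(1)] by blast
  \<comment> \<open>Here \<open>related\<close> enters: adding this to the approximate inclusion
    leaves only \<open>(norm y)\<^sup>2 / 2 + h x\<close>, up to errors of order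
    \<open>e\<close>.\<close>
  have 1: "B s s' + p s \<ge> 0" using w(2) p_ge[OF w(1), of s] by (simp add: B_simps)
  have 2: "B y x - B s s' = B (y - s) x - B s (s' - x)" by (simp add: B_simps)
  have 3: "norm (s - y) * norm x \<le> e * R" using *(3,4) e0 by (intro mult_mono) auto
  have 4: "norm s * norm (s' - x) \<le> (R + 1) * e" using s *(5) R by (intro mult_mono) auto
  have 5: "B (y - s) x \<ge> - (e * R)" using bound[of "y - s" x] 3 by (simp add: norm_minus_commute)
  have 6: "B s (s' - x) \<le> (R + 1) * e" using bound[of s "s' - x"] 4 by simp
  have 7: "p s \<le> p y + M * e"
    using p_diff_le[of s y] mult_left_mono[OF *(4) M_nonneg] by linarith
  have eK: "e * K = e + (e * R + (R + 1) * e + M * e)" by (simp add: K_def algebra_simps)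
  have small: "(norm y)\<^sup>2 / 2 + h x \<le> e * K"
    using 1 2 5 6 7 *(6) unfolding eK g_def by linarith
  have hx: "h x \<le> e * K" using small zero_le_power2[of "norm y"] by linarith
  have "e * (2 * K) \<le> (d / 2)\<^sup>2" using iffD1[OF pos_le_divide_eq e(3)] K by simp
  then have "(norm y)\<^sup>2 \<le> (d / 2)\<^sup>2" using small h_nonneg[of x] by linarith
  then have "norm y \<le> d / 2" by (rule power2_le_imp_le) (use d in simp)
  then have "norm s \<le> d" using *(4) e(2) norm_triangle_ineq[of "s - y" y] by simp
  moreover have "- B v s' \<le> p v + d"
  proof -
    have "- B v x \<le> p v + t * (norm v)\<^sup>2 / 2 + e * K / t"
      by (rule minus_le_support_if_conjugate_small[OF hx t])
    moreover have "e * K / t \<le> d / 3"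
    proof -
      have "e * (3 * K) \<le> d * t" using iffD1[OF pos_le_divide_eq e(4)] K by simp
      then have "e * K \<le> d / 3 * t" by simp
      then show ?thesis by (rule iffD2[OF pos_divide_le_eq[OF t]])
    qed
    moreover have "- B v (s' - x) \<le> d / 3"
    proof -
      have "- B v (s' - x) \<le> norm v * norm (s' - x)" using bound[of v "s' - x"] by linarith
      also have "\<dots> \<le> (norm v + 1) * e" using *(5) by (intro mult_mono) auto
      also have "\<dots> \<le> d / 3"
      proof -
        have "norm v + 1 > 0" by (simp add: add_nonneg_pos)
        then have "e * (3 * (norm v + 1)) \<le> d" using iffD1[OF pos_le_divide_eq e(5)] by simp
        then show ?thesis by (simp add: algebra_simps)
      qed
      finally show ?thesis .
    qed
    moreover have "B v s' = B v x + B v (s' - x)" by (simp add: B_simps)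
    ultimately show ?thesis using tv by linarith
  qed
  ultimately show ?thesis using *(1) s' by blast
qed

lemma ex_related_to_all:
  fixes \<Gamma> :: "('v \<times> 'x) set"
  assumes mono: "\<And>y x s s'. (y, x) \<in> \<Gamma> \<Longrightarrow> (s, s') \<in> \<Gamma> \<Longrightarrow> B (y - s) (x - s') \<ge> 0"
    and related: "\<And>y x. (y, x) \<in> \<Gamma> \<Longrightarrow> \<exists>w\<in>W. B y (x - w) \<ge> 0"
    and approx: "\<And>e. e > 0 \<Longrightarrow> e \<le> 1 \<Longrightarrow> \<exists>y x s s'. (s, s') \<in> \<Gamma> \<and> norm y \<le> R \<and> norm x \<le> R \<and>
        norm (s - y) \<le> e \<and> norm (s' - x) \<le> e \<and> g y + h x + B y x \<le> e"
  obtains w where "w \<in> W" "\<And>y x. (y, x) \<in> \<Gamma> \<Longrightarrow> B y (x - w) \<ge> 0"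
proof -
  \<comment> \<open>Monotonicity against the approximating points is averaged with the weights
    \<open>c\<close>. As \<open>s\<close> tends to 0 only \<open>q + p v \<ge> 0\<close> survives,
    and a \<open>w\<close> attaining \<open>p v\<close> is the required point.\<close>
  have comb: "\<exists>w\<in>W. (\<Sum>i\<in>I. c i * (B (fst i) (snd i) - B (fst i) w)) \<ge> 0"
    if I: "finite I" "I \<subseteq> \<Gamma>" "\<And>i. i \<in> I \<Longrightarrow> c i \<ge> 0" "sum c I = 1" for I and c :: "'v \<times> 'x \<Rightarrow> real"
  proof -
    define v where "v = (\<Sum>i\<in>I. c i *\<^sub>R fst i)"
    define u where "u = (\<Sum>i\<in>I. c i *\<^sub>R snd i)"
    define q where "q = (\<Sum>i\<in>I. c i * B (fst i) (snd i))"
    have Bv: "(\<Sum>i\<in>I. c i * B (fst i) x) = B v x" for x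
      unfolding v_def by (simp add: bounded_bilinear.sum_left[OF bilinear] B_simps)
    have Bu: "(\<Sum>i\<in>I. c i * B y (snd i)) = B y u" for y
      unfolding u_def by (simp add: bounded_bilinear.sum_right[OF bilinear] B_simps)
    have lb: "0 \<le> q + p v + d * (norm u + R + 2)" if d: "d > 0" for d
    proof -
      obtain s s' where s: "(s, s') \<in> \<Gamma>" "norm s \<le> d" "norm s' \<le> R + 1" "- B v s' \<le> p v + d"
        using approximation_converges[OF related approx d] by blast
      have "0 \<le> (\<Sum>i\<in>I. c i * B (fst i - s) (snd i - s'))"
        using I(2,3) s(1) by (intro sum_nonneg mult_nonneg_nonneg mono) auto
      also have "\<dots> = (\<Sum>i\<in>I. c i * B (fst i) (snd i) - c i * B (fst i) s' - c i * B s (snd i) + c i * B s s')"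
        by (intro sum.cong refl) (simp add: B_simps algebra_simps)
      also have "\<dots> = q - B v s' - B s u + B s s'"
        using I(4) by (simp add: sum.distrib sum_subtractf Bv Bu q_def sum_distrib_right[symmetric])
      finally have 1: "0 \<le> q - B v s' - B s u + B s s'" .
      have "norm s * norm u \<le> d * norm u" using s(2) by (rule mult_right_mono) simp
      then have 2: "- B s u \<le> d * norm u" using bound[of s u] by linarith
      have "norm s * norm s' \<le> d * (R + 1)" using s(2,3) d by (intro mult_mono) auto
      then have 3: "B s s' \<le> d * (R + 1)" using bound[of s s'] by linarith
      have "d * (norm u + R + 2) = d * norm u + d * (R + 1) + d" by (simp add: algebra_simps)
      then show ?thesis using 1 2 3 s(4) by linarith
    qed
    have R: "R \<ge> 0" using approx[of 1] by (auto intro: order_trans[OF norm_ge_zero])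
    have "0 \<le> q + p v"
    proof (rule field_le_epsilon)
      fix e :: real assume "e > 0"
      moreover have pos: "norm u + R + 2 > 0" using R norm_ge_zero[of u] by linarith
      ultimately show "0 \<le> q + p v + e" using lb[of "e / (norm u + R + 2)"] by simp
    qed
    moreover obtain w where "w \<in> W" "p v = - B v w" by (metis p_attained)
    moreover have "(\<Sum>i\<in>I. c i * (B (fst i) (snd i) - B (fst i) w)) = q - B v w" for w
      by (simp add: right_diff_distrib sum_subtractf Bv q_def)
    ultimately show ?thesis by (intro bexI[of _ w]) auto
  qed
  show ?thesis
  proof (rule affine_minimax[OF W, of \<Gamma> "\<lambda>i w. B (fst i) (snd i) - B (fst i) w"])
    show "continuous_map T euclideanreal (\<lambda>w. B (fst i) (snd i) - B (fst i) w)" for i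
      using cont by (intro continuous_map_diff) auto
    show "B (fst i) (snd i) - B (fst i) ((1 - t) *\<^sub>R x + t *\<^sub>R y) =
        (1 - t) * (B (fst i) (snd i) - B (fst i) x) + t * (B (fst i) (snd i) - B (fst i) y)" for i x y t
      by (simp add: B_simps algebra_simps)
    fix w assume w: "w \<in> W" "\<And>i. i \<in> \<Gamma> \<Longrightarrow> 0 \<le> B (fst i) (snd i) - B (fst i) w"
    show thesis
      using w(2) by (intro that[OF w(1)]) (force simp: B_simps)
  qed (rule comb)
qed

end

subsection \<open>Weakly and weak-star compact sets\<close>

lemma continuous_map_weak_topology:
  "continuous_map weak_topology euclideanreal (blinfun_apply f)"
proof -
  have "openin weak_topology {x. blinfun_apply f x \<in> U}" if "open U" for U
    unfolding weak_topology_def using that by (intro topology_generated_by_Basis) blast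
  moreover have "topspace (weak_topology :: 'a topology) = UNIV"
    using openin_subset[OF calculation[OF open_UNIV]] by auto
  ultimately show ?thesis by (simp add: continuous_map_def)
qed

lemma continuous_map_weak_star_topology:
  "continuous_map weak_star_topology euclideanreal (\<lambda>f. blinfun_apply f x)"
proof -
  have "openin weak_star_topology {f. blinfun_apply f x \<in> U}" if "open U" for U
    unfolding weak_star_topology_def using that by (intro topology_generated_by_Basis) blast
  moreover have "topspace (weak_star_topology :: ('a \<Rightarrow>\<^sub>L real) topology) = UNIV"
    using openin_subset[OF calculation[OF open_UNIV]] by auto
  ultimately show ?thesis by (simp add: continuous_map_def)
qed

lemma compactin_real_image_bounded:
  assumes "compactin T K" "continuous_map T euclideanreal f"
  shows "\<exists>B. \<forall>x\<in>K. \<bar>f x\<bar> \<le> (B::real)"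
proof -
  have "compact (f ` K)" using image_compactin[OF assms] by simp
  then show ?thesis using compact_imp_bounded[of "f ` K"] by (auto simp: bounded_iff)
qed

lemma weak_star_compact_bounded:
  fixes W :: "('a::banach \<Rightarrow>\<^sub>L real) set"
  assumes "compactin weak_star_topology W"
  obtains M where "\<And>f. f \<in> W \<Longrightarrow> norm f \<le> M"
  using uniform_boundedness[of W] compactin_real_image_bounded[OF assms continuous_map_weak_star_topology]
  by blast

text \<open>The canonical embedding \<open>J\<close> turns \<open>W\<close> into functionals on the
  dual, which is complete, so uniform boundedness applies there; norming functionals bring the bound
  back to \<open>W\<close>.\<close>

lemma weak_compact_bounded:
  fixes W :: "'a::real_normed_vector set"
  assumes "compactin weak_topology W"
  obtains M where "\<And>x. x \<in> W \<Longrightarrow> norm x \<le> M"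
proof -
  define J :: "'a \<Rightarrow> ('a \<Rightarrow>\<^sub>L real) \<Rightarrow>\<^sub>L real" where "J x = Blinfun (\<lambda>f. blinfun_apply f x)" for x
  have J: "blinfun_apply (J x) f = blinfun_apply f x" for x f
    unfolding J_def by (subst bounded_linear_Blinfun_apply) (auto intro: bounded_linear_intros)
  have "\<exists>B. \<forall>F\<in>J ` W. \<bar>blinfun_apply F f\<bar> \<le> B" for f
    using compactin_real_image_bounded[OF assms continuous_map_weak_topology[of f]] by (simp add: J)
  then obtain M where M: "\<And>F. F \<in> J ` W \<Longrightarrow> norm F \<le> M"
    using uniform_boundedness[of "J ` W"] by blast
  show ?thesis
  proof (rule that)
    fix x assume x: "x \<in> W"
    obtain f :: "'a \<Rightarrow>\<^sub>L real" where f: "norm f \<le> 1" "blinfun_apply f x = norm x"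
      by (rule ex_norming_functional)
    have "norm x \<le> norm (J x) * norm f" using norm_blinfun[of "J x" f] f(2) by (simp add: J)
    also have "\<dots> \<le> norm (J x)" using f(1) by (simp add: mult_left_le)
    also have "\<dots> \<le> M" using M x by blast
    finally show "norm x \<le> M" .
  qed
qed

lemma normed_pairing_blinfun: "normed_pairing (blinfun_apply :: ('a::real_normed_vector \<Rightarrow>\<^sub>L real) \<Rightarrow> 'a \<Rightarrow> real)"
proof (rule normed_pairing.intro)
  show "bounded_bilinear (blinfun_apply :: ('a \<Rightarrow>\<^sub>L real) \<Rightarrow> 'a \<Rightarrow> real)"
    by (rule bounded_bilinear_blinfun_apply)
  show "\<bar>blinfun_apply y x\<bar> \<le> norm y * norm x" for y :: "'a \<Rightarrow>\<^sub>L real" and x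
    using norm_blinfun[of y x] by simp
  show "\<exists>x. norm x \<le> r \<and> blinfun_apply y x \<le> - r * norm y + e" if "r \<ge> 0" "e > 0" for r e and y :: "'a \<Rightarrow>\<^sub>L real"
    using blinfun_near_minimum_on_ball[OF that] by metis
  show "\<exists>y. norm y \<le> r \<and> blinfun_apply y x \<le> - r * norm x + e" if "r \<ge> 0" "e > 0" for r e and x :: 'a
  proof -
    obtain f :: "'a \<Rightarrow>\<^sub>L real" where f: "norm f \<le> 1" "blinfun_apply f x = norm x"
      by (rule ex_norming_functional)
    then show ?thesis
      using that by (intro exI[of _ "- r *\<^sub>R f"]) (auto simp: blinfun.bilinear_simps mult_left_le)
  qed
qed

lemma normed_pairing_flip:
  assumes "normed_pairing B"
  shows "normed_pairing (\<lambda>y x. B x y)"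
proof -
  interpret normed_pairing B by fact
  show ?thesis
  proof (rule normed_pairing.intro)
    show "bounded_bilinear (\<lambda>y x. B x y)" by (rule bounded_bilinear.flip[OF bilinear])
    show "\<bar>B x y\<bar> \<le> norm y * norm x" for x y using bound[of x y] by (simp add: mult.commute)
  qed (fact norming_left norming_right)+
qed

section \<open>Translation of graphs and the two cases of the theorem\<close>

lemma monotone_graph_translate:
  assumes "monotone_graph G"
  shows "monotone_graph ((\<lambda>p. p - a) ` G)"
proof -
  have "blinfun_apply (snd p - snd q) (fst p - fst q) \<ge> 0" if "p \<in> G" "q \<in> G" for p q
    using assms that by (auto simp: monotone_graph_def split_beta)
  then show ?thesis by (auto simp: monotone_graph_def split_beta)
qed

lemma quasidense_translate:
  assumes "quasidense G"
  shows "quasidense ((\<lambda>p. p - a) ` G)"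
  unfolding quasidense_def
proof (intro allI)
  fix x x'
  have "(INF p\<in>G. norm (fst p - (x + fst a))^2 / 2 + norm (snd p - (x' + snd a))^2 / 2
                         + blinfun_apply (snd p - (x' + snd a)) (fst p - (x + fst a))) \<le> 0"
    using assms unfolding quasidense_def by blast
  then show "(INF p\<in>(\<lambda>p. p - a) ` G. norm (fst p - x)^2 / 2 + norm (snd p - x')^2 / 2
                         + blinfun_apply (snd p - x') (fst p - x)) \<le> 0"
    by (simp add: image_image diff_diff_eq add.commute)
qed

text \<open>The flipped pairing puts \<open>W\<close> on the dual side, so \<open>g\<close> lives on
  the space and \<open>h\<close> on its dual, as in \<open>quasidense_approximate_inclusion\<close>.
  Translating by \<open>(w, 0)\<close> moves the base point to 0.\<close>

lemma quasidense_meets_weak_star_compact: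
  fixes G :: "('a::banach \<times> ('a \<Rightarrow>\<^sub>L real)) set"
  assumes G: "G \<noteq> {}" "closed G" "monotone_graph G" "quasidense G"
    and W: "W \<noteq> {}" "compactin weak_star_topology W" "convex W"
    and related: "\<And>s s'. (s, s') \<in> G \<Longrightarrow> \<exists>x'\<in>W. blinfun_apply (s' - x') (s - w) \<ge> 0"
  obtains x' where "x' \<in> W" "(w, x') \<in> G"
proof -
  obtain M where M: "\<And>f. f \<in> W \<Longrightarrow> norm f \<le> M" using weak_star_compact_bounded[OF W(2)] by blast
  interpret compact_support "\<lambda>x f. blinfun_apply f x" weak_star_topology W M
    using W M continuous_map_weak_star_topology normed_pairing_flip[OF normed_pairing_blinfun]
    by (intro compact_support.intro compact_support_axioms.intro) auto
  define G' where "G' = (\<lambda>p. p - (w, 0)) ` G"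
  have mem: "(y, f) \<in> G' \<longleftrightarrow> (y + w, f) \<in> G" for y f
    by (force simp: G'_def image_iff)
  have G': "G' \<noteq> {}" "monotone_graph G'" "quasidense G'"
    unfolding G'_def using G(1) monotone_graph_translate[OF G(3)] quasidense_translate[OF G(4)] by simp_all
  obtain R where "\<forall>e>0. e \<le> 1 \<longrightarrow> (\<exists>x x' s s'. (s, s') \<in> G' \<and> norm x \<le> R \<and> norm x' \<le> R \<and>
      norm (s - x) \<le> e \<and> norm (s' - x') \<le> e \<and> g x + h x' + blinfun_apply x' x \<le> e)"
    using quasidense_approximate_inclusion[OF G' g_convex g_bounded h_convex h_bounded
        fenchel_young tight_left coercive] by blast
  moreover have "blinfun_apply (f - s') (y - s) \<ge> 0" if "(y, f) \<in> G'" "(s, s') \<in> G'" for y f s s'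
    using G'(2) that by (auto simp: monotone_graph_def)
  moreover have "\<exists>x'\<in>W. blinfun_apply (f - x') y \<ge> 0" if "(y, f) \<in> G'" for y f
    using related[of "y + w" f] that by (simp add: mem)
  ultimately obtain x' where x': "x' \<in> W" "\<And>y f. (y, f) \<in> G' \<Longrightarrow> blinfun_apply (f - x') y \<ge> 0"
    using ex_related_to_all[of G' R] by blast
  have "(w, x') \<in> G"
    using x'(2)[of "_ - w"] by (intro quasidense_maximal[OF G(2,4,1)]) (simp add: mem)
  then show ?thesis using that x'(1) by blast
qed

lemma quasidense_meets_weak_compact:
  fixes G :: "('a::real_normed_vector \<times> ('a \<Rightarrow>\<^sub>L real)) set"
  assumes G: "G \<noteq> {}" "closed G" "monotone_graph G" "quasidense G"
    and W: "W \<noteq> {}" "compactin weak_topology W" "convex W"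
    and related: "\<And>s s'. (s, s') \<in> G \<Longrightarrow> \<exists>x\<in>W. blinfun_apply (s' - w') (s - x) \<ge> 0"
  obtains x where "x \<in> W" "(x, w') \<in> G"
proof -
  obtain M where M: "\<And>f. f \<in> W \<Longrightarrow> norm f \<le> M" using weak_compact_bounded[OF W(2)] by blast
  interpret compact_support "blinfun_apply :: ('a \<Rightarrow>\<^sub>L real) \<Rightarrow> 'a \<Rightarrow> real" weak_topology W M
    using W M continuous_map_weak_topology normed_pairing_blinfun
    by (intro compact_support.intro compact_support_axioms.intro) auto
  define G' where "G' = (\<lambda>p. p - (0, w')) ` G"
  have mem: "(y, f) \<in> G' \<longleftrightarrow> (y, f + w') \<in> G" for y f
    by (force simp: G'_def image_iff)
  have G': "G' \<noteq> {}" "monotone_graph G'" "quasidense G'"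
    unfolding G'_def using G(1) monotone_graph_translate[OF G(3)] quasidense_translate[OF G(4)] by simp_all
  have "\<exists>R. \<forall>e>0. e \<le> 1 \<longrightarrow> (\<exists>x x' s s'. (s, s') \<in> G' \<and> norm x \<le> R \<and> norm x' \<le> R \<and>
      norm (s - x) \<le> e \<and> norm (s' - x') \<le> e \<and> h x + g x' + blinfun_apply x' x \<le> e)"
  \<comment> \<open>Now \<open>g\<close> lives on the dual and its conjugate \<open>h\<close> on the
    space, so the two exchange roles and tightness comes from \<open>tight_right\<close>.\<close>
  proof (rule quasidense_approximate_inclusion[OF G' h_convex h_bounded g_convex g_bounded])
    show "- blinfun_apply f x \<le> h x + g f" for x f using fenchel_young[of f x] by simp
    show "\<exists>x. h x + blinfun_apply u x + g u \<le> e" if "e > 0" for u e using tight_right[OF that] .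
    show "\<exists>C. \<forall>x f. r * (norm x + norm f) - C \<le> h x + g f" if "r \<ge> 0" for r
      using coercive[OF that] by (metis add.commute)
  qed
  then obtain R where R: "\<And>e. e > 0 \<Longrightarrow> e \<le> 1 \<Longrightarrow> \<exists>x x' s s'. (s, s') \<in> G' \<and> norm x \<le> R \<and> norm x' \<le> R \<and>
      norm (s - x) \<le> e \<and> norm (s' - x') \<le> e \<and> h x + g x' + blinfun_apply x' x \<le> e"
    by blast
  \<comment> \<open>The graph is transposed to match the order of the pairing in the locale.\<close>
  define \<Gamma> where "\<Gamma> = {(f, y). (y, f) \<in> G'}"
  have "\<exists>f y s s'. (s, s') \<in> \<Gamma> \<and> norm f \<le> R \<and> norm y \<le> R \<and>
      norm (s - f) \<le> e \<and> norm (s' - y) \<le> e \<and> g f + h y + blinfun_apply f y \<le> e" if "e > 0" "e \<le> 1" for e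
    using R[OF that] by (fastforce simp: \<Gamma>_def add.commute)
  moreover have "blinfun_apply (f - s') (y - s) \<ge> 0" if "(f, y) \<in> \<Gamma>" "(s', s) \<in> \<Gamma>" for y f s s'
    using G'(2) that by (auto simp: monotone_graph_def \<Gamma>_def)
  moreover have "\<exists>x\<in>W. blinfun_apply f (y - x) \<ge> 0" if "(f, y) \<in> \<Gamma>" for y f
    using related[of y "f + w'"] that by (simp add: mem \<Gamma>_def)
  ultimately obtain x where x: "x \<in> W" "\<And>f y. (f, y) \<in> \<Gamma> \<Longrightarrow> blinfun_apply f (y - x) \<ge> 0"
    using ex_related_to_all[of \<Gamma> R] by blast
  have "(x, w') \<in> G"
    using x(2)[of "_ - w'"] by (intro quasidense_maximal[OF G(2,4,1)]) (simp add: mem \<Gamma>_def)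
  then show ?thesis using that x(1) by blast
qed

theorem theorem6p5:
  fixes G :: "('a::banach \<times> ('a \<Rightarrow>\<^sub>L real)) set"
  assumes nonzero: "\<exists>x::'a. x \<noteq> 0"
    and nonempty: "G \<noteq> {}"
    and closed: "closed G"
    and mono: "monotone_graph G"
    and qd: "quasidense G"
  shows "(\<forall>w Wt. Wt \<noteq> {} \<and> compactin weak_star_topology Wt \<and> convex Wt \<and>
            (\<forall>(s, s') \<in> G. \<exists>x'\<in>Wt. blinfun_apply (s' - x') (s - w) \<ge> 0)
           \<longrightarrow> {s'. (w, s') \<in> G} \<inter> Wt \<noteq> {})
       \<and> (\<forall>W w'. W \<noteq> {} \<and> compactin weak_topology W \<and> convex W \<and>
            (\<forall>(s, s') \<in> G. \<exists>x\<in>W. blinfun_apply (s' - w') (s - x) \<ge> 0)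
           \<longrightarrow> (\<exists>x\<in>W. (x, w') \<in> G))"
proof (intro conjI allI impI; elim conjE)
  fix w and Wt :: "('a \<Rightarrow>\<^sub>L real) set"
  assume Wt: "Wt \<noteq> {}" "compactin weak_star_topology Wt" "convex Wt"
    and rel: "\<forall>(s, s') \<in> G. \<exists>x'\<in>Wt. blinfun_apply (s' - x') (s - w) \<ge> 0"
  show "{s'. (w, s') \<in> G} \<inter> Wt \<noteq> {}"
  proof (rule quasidense_meets_weak_star_compact[OF nonempty closed mono qd Wt])
    show "\<exists>x'\<in>Wt. blinfun_apply (s' - x') (s - w) \<ge> 0" if "(s, s') \<in> G" for s s'
      using rel that by fast
  qed blast
next
  fix w' and W :: "'a set"
  assume W: "W \<noteq> {}" "compactin weak_topology W" "convex W"
    and rel: "\<forall>(s, s') \<in> G. \<exists>x\<in>W. blinfun_apply (s' - w') (s - x) \<ge> 0"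
  show "\<exists>x\<in>W. (x, w') \<in> G"
  proof (rule quasidense_meets_weak_compact[OF nonempty closed mono qd W])
    show "\<exists>x\<in>W. blinfun_apply (s' - w') (s - x) \<ge> 0" if "(s, s') \<in> G" for s s'
      using rel that by fast
  qed blast
qed

end
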